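(* If a half-infinite geodesic on the L-surface that does not hit a vertex of the L-surface has a slope that is a badly approximable number, then it is superdense on the L-surface.
   Context: The L-surface is obtained from the L-shaped region $[0,1]^2\cup([1,2]\times[0,1])\cup([0,1]\times[1,2])$, a union of $3$ unit squares, by identifying the following pairs of boundary edges by translation: $[0,1]\times\{0\}$ with $[0,1]\times\{2\}$; $[1,2]\times\{0\}$ with $[1,2]\times\{1\}$; $\{0\}\times[0,1]$ with $\{2\}\times[0,1]$; $\{0\}\times[1,2]$ with $\{1\}\times[1,2]$. After identification all corners of the squares become a single vertex. The surface carries the flat metric of the squares. A half-infinite geodesic $\mathcal{L}(t)$, $t\ge0$, is a straight unit-speed path in a fixed direction on the L-surface, with arc-length parametrization; its slope is the slope of this direction. A half-infinite geodesic $\mathcal{L}(t)$, $t\ge0$, is superdense on the L-surface if there exists a constant $C_1=C_1(\mathcal{L})>0$ such that, for every integer $n\ge1$, the initial segment $\mathcal{L}(t)$, $0\le t\le C_1n$, gets $(1/n)$-close to every point of the L-surface. An irrational number $\alpha$ with continued fraction $\alpha=[a_0;a_1,a_2,a_3,\ldots]$ is badly approximable if there exists a constant $A$ such that $a_i\le A$ for every $i=0,1,2,3,\ldots$. *)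

theory Defs
  imports "HOL-Analysis.Analysis"
begin

section \<open>The L-surface\<close>

definition L_squares :: "(real \<times> real) set set" where
  "L_squares = {{0..1} \<times> {0..1}, {1..2} \<times> {0..1}, {0..1} \<times> {1..2}}"

definition L_region :: "(real \<times> real) set" where
  "L_region = \<Union> L_squares"

definition L_glue :: "((real \<times> real) \<times> (real \<times> real)) set" where
  "L_glue = {((x, 0), (x, 2)) | x. x \<in> {0..1}} \<union> {((x, 0), (x, 1)) | x. x \<in> {1..2}}
          \<union> {((0, y), (2, y)) | y. y \<in> {0..1}} \<union> {((0, y), (1, y)) | y. y \<in> {1..2}}"

definition L_rel :: "((real \<times> real) \<times> (real \<times> real)) set" where
  "L_rel = {(p, q). p \<in> L_region \<and> q \<in> L_region \<and> (p, q) \<in> (L_glue \<union> L_glue\<inverse>)\<^sup>*}"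

definition L_surface :: "(real \<times> real) set set" where
  "L_surface = L_region // L_rel"

definition L_vertex :: "(real \<times> real) set" where
  "L_vertex = L_rel `` {(0, 0)}"

lemma equiv_L_rel: "equiv L_region L_rel"
proof (rule equivI)
  show "L_rel \<subseteq> L_region \<times> L_region"
    by (auto simp: L_rel_def)
  show "refl_on L_region L_rel"
    by (auto simp: refl_on_def L_rel_def)
  have "sym ((L_glue \<union> L_glue\<inverse>)\<^sup>*)"
    by (intro sym_rtrancl) (auto simp: sym_def)
  then show "sym L_rel"
    by (auto simp: L_rel_def sym_def)
  show "trans L_rel"
    unfolding L_rel_def trans_def by (auto intro: rtrancl_trans)
qed

lemma L_glue_subset: "L_glue \<subseteq> L_rel"
  by (auto simp: L_glue_def L_rel_def L_region_def L_squares_def intro!: r_into_rtrancl)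

text \<open>All eight corners of the squares are the same point of the surface.\<close>

lemma L_vertex_corners:
  assumes "p \<in> {(0,0), (1,0), (2,0), (0,1), (1,1), (2,1), (0,2), (1,2)}"
  shows "L_rel `` {p} = L_vertex"
proof -
  let ?c = "\<lambda>p. L_rel `` {p}"
  have g: "?c p = ?c q" if "(p, q) \<in> L_glue" for p q
    using that L_glue_subset equiv_class_eq[OF equiv_L_rel] by blast
  have "?c (0,0) = ?c (0,2)" "?c (1,0) = ?c (1,2)" "?c (1,0) = ?c (1,1)" "?c (2,0) = ?c (2,1)"
       "?c (0,0) = ?c (2,0)" "?c (0,1) = ?c (2,1)" "?c (0,1) = ?c (1,1)" "?c (0,2) = ?c (1,2)"
    by (rule g; simp add: L_glue_def)+
  then show ?thesis
    using assms unfolding L_vertex_def by auto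
qed

text \<open>The flat metric of the surface is the quotient metric: the infimum of the lengths of strings
  of straight segments, each inside one closed unit square, whose endpoints are matched
  up to the identifications.\<close>

inductive L_chain :: "real \<times> real \<Rightarrow> real \<times> real \<Rightarrow> real \<Rightarrow> bool" where
  start: "p \<in> L_region \<Longrightarrow> L_chain p p 0"
| segment: "L_chain p q l \<Longrightarrow> S \<in> L_squares \<Longrightarrow> q \<in> S \<Longrightarrow> r \<in> S \<Longrightarrow> L_chain p r (l + dist q r)"
| identify: "L_chain p q l \<Longrightarrow> (q, r) \<in> L_rel \<Longrightarrow> L_chain p r l"

definition L_dist :: "(real \<times> real) set \<Rightarrow> (real \<times> real) set \<Rightarrow> real" where
  "L_dist P Q = Inf {l. \<exists>p\<in>P. \<exists>q\<in>Q. L_chain p q l}"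

text \<open>The infimum is over a nonempty set that is bounded below, because the three squares share
  the corner \<open>(1, 1)\<close>.\<close>

lemma L_chain_nonneg: "L_chain p q l \<Longrightarrow> 0 \<le> l"
  by (induction rule: L_chain.induct) auto

lemma L_chain_exists:
  assumes "p \<in> L_region" "q \<in> L_region"
  shows "\<exists>l. L_chain p q l"
proof -
  have centre: "(1, 1) \<in> S" if "S \<in> L_squares" for S
    using that by (auto simp: L_squares_def)
  obtain S T where "S \<in> L_squares" "p \<in> S" "T \<in> L_squares" "q \<in> T"
    using assms by (auto simp: L_region_def)
  then have "L_chain p q (0 + dist p (1, 1) + dist (1, 1) q)"
    using assms centre by (blast intro: L_chain.intros)
  then show ?thesis ..
qed

section \<open>Geodesics\<close>

text \<open>A unit-speed straight path in direction \<open>v\<close>: around each time \<open>t \<ge> 0\<close> it runs along \<open>v\<close> in the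
  region, after as well as before \<open>t\<close>. The representatives \<open>p\<close> and \<open>q\<close> of the point at time \<open>t\<close>
  differ when the path crosses an identified edge. At points other than the vertex this
  is local straightness for the flat structure; a path through the vertex may leave it
  along any of the available sheets.\<close>

definition L_geodesic :: "(real \<Rightarrow> (real \<times> real) set) \<Rightarrow> real \<times> real \<Rightarrow> bool" where
  "L_geodesic \<gamma> v \<longleftrightarrow> norm v = 1 \<and> (\<forall>t\<ge>0. \<gamma> t \<in> L_surface) \<and>
     (\<forall>t\<ge>0. \<exists>p q. \<exists>e>0.
        (\<forall>s\<in>{0..<e}. p + s *\<^sub>R v \<in> \<gamma> (t + s)) \<and>
        (\<forall>s\<in>{0..<e}. s \<le> t \<longrightarrow> q - s *\<^sub>R v \<in> \<gamma> (t - s)))"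

text \<open>For vertical \<open>v\<close> this gives \<open>0\<close>, which is rational and hence not badly approximable.\<close>

definition slope :: "real \<times> real \<Rightarrow> real" where
  "slope v = snd v / fst v"

definition L_superdense :: "(real \<Rightarrow> (real \<times> real) set) \<Rightarrow> bool" where
  "L_superdense \<gamma> \<longleftrightarrow>
     (\<exists>C>0. \<forall>n::nat. n \<ge> 1 \<longrightarrow>
        (\<forall>Q\<in>L_surface. \<exists>t\<in>{0..C * real n}. L_dist (\<gamma> t) Q \<le> 1 / real n))"

section \<open>Continued fractions\<close>

primrec cf_remainder :: "real \<Rightarrow> nat \<Rightarrow> real" where
  "cf_remainder \<alpha> 0 = \<alpha>"
| "cf_remainder \<alpha> (Suc i) = 1 / frac (cf_remainder \<alpha> i)"

definition cf_digit :: "real \<Rightarrow> nat \<Rightarrow> int" where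
  "cf_digit \<alpha> i = \<lfloor>cf_remainder \<alpha> i\<rfloor>"

definition badly_approximable :: "real \<Rightarrow> bool" where
  "badly_approximable \<alpha> \<longleftrightarrow> \<alpha> \<notin> \<rat> \<and> (\<exists>A. \<forall>i. cf_digit \<alpha> i \<le> A)"

end

(*
  Cutting and regluing the surface along a basis (e1, e2) of the integer lattice presents it as three
  parallelograms glued by two noncommuting permutations H, V of three letters. Running the continued
  fraction algorithm on the slope makes both sides follow the direction of the geodesic, so that
  cylinders in direction e1 have transversal width 1/q, where q is the horizontal component of e1,
  and one crossing of a cylinder takes time comparable to q.

  The returns to the bottom sides of the parallelograms form a skew product over the rotation by the
  complete quotient R. If H is an involution and the geodesic misses its fixed letter, all these
  crossings wrap around the same number of times, so R is close to an integer; bounded digits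
  exclude this for long orbits. So all sides are met within boundedly many crossings as soon as H is
  an involution and a mild extra condition holds, and of three consecutive levels one is of this kind.
  Once all bottom sides are met, every point has a vertical segment of length at most 2/q to the
  geodesic.
*)
theory Submission
  imports Defs
begin

text \<open>Modulo the integer lattice this is the classical statement for a torus; the obstacle is
  that the geodesic might avoid one of the three sheets for a long time. Noncommutation of
  \<open>H\<close> and \<open>V\<close> survives every step, and parity of permutations decides
  which levels are good. Even permutations of three letters commute, and odd ones are
  transpositions. So if \<open>H\<close> is a 3-cycle, then \<open>V\<close> and every
  \<open>V \<circ> H ^^ m\<close> are odd, and the next level has an involution. The extra
  condition, that \<open>V\<close> is an involution or the quotient is at least 2, can fail only for
  a 3-cycle \<open>V\<close> with digit 1; then the next permutation \<open>V \<circ> H\<close> is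
  odd and comes with the involution \<open>H\<close>, so one more level suffices. The time scale
  comes from the horizontal speed \<open>X * q + Y * q'\<close>, which every step preserves. With
  quotients at most \<open>B\<close> and \<open>q' \<le> q\<close> it bounds the crossing time
  \<open>1 / Y\<close> by a constant times \<open>q\<close>.\<close>

section \<open>Classes of the gluing relation\<close>

lemma L_glue_iff:
  "((a, b), (c, d)) \<in> L_glue \<longleftrightarrow>
    a = c \<and> (0 \<le> a \<and> a \<le> 1 \<and> b = 0 \<and> d = 2 \<or> 1 \<le> a \<and> a \<le> 2 \<and> b = 0 \<and> d = 1) \<or>
    b = d \<and> (0 \<le> b \<and> b \<le> 1 \<and> a = 0 \<and> c = 2 \<or> 1 \<le> b \<and> b \<le> 2 \<and> a = 0 \<and> c = 1)"
  unfolding L_glue_def by auto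

text \<open>Away from the corners a boundary point is glued to exactly one other, so a second gluing
  step can only undo the first.\<close>

lemma L_glue_comp:
  assumes "(p, q) \<in> L_glue \<union> L_glue\<inverse>" "(q, r) \<in> L_glue \<union> L_glue\<inverse>"
  shows "p = r \<or> p \<in> {0,1,2} \<times> {0,1,2} \<and> r \<in> {0,1,2} \<times> {0,1,2}"
proof -
  obtain p1 p2 q1 q2 r1 r2 where eqs: "p = (p1, p2)" "q = (q1, q2)" "r = (r1, r2)"
    by (meson surj_pair)
  show ?thesis
    using assms unfolding eqs Un_iff converse_iff L_glue_iff
    by (elim disjE conjE; simp)
qed

lemma L_glue_corner:
  assumes "(p, q) \<in> L_glue \<union> L_glue\<inverse>" "p \<in> {0,1,2} \<times> {0,1,2}"
  shows "q \<in> {0,1,2} \<times> {0,1,2}"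
  using assms by (cases p; cases q) (auto simp: L_glue_iff)

text \<open>Strings of gluing steps collapse by \<open>L_glue_comp\<close>; hence every class other
  than that of the corners has at most two elements.\<close>

lemma L_rel_cases:
  assumes "(p, q) \<in> L_rel"
  shows "p = q \<or> (p, q) \<in> L_glue \<union> L_glue\<inverse> \<or>
    (p \<in> {0,1,2} \<times> {0,1,2} \<and> q \<in> {0,1,2} \<times> {0,1,2})"
proof -
  have "(p, q) \<in> (L_glue \<union> L_glue\<inverse>)\<^sup>*"
    using assms by (simp add: L_rel_def)
  then show ?thesis
  proof (induction rule: rtrancl_induct)
    case base
    then show ?case by simp
  next
    case (step y z)
    then show ?case
      using L_glue_comp[of p y z] L_glue_corner[of y z] by blast
  qed
qed

lemma L_surface_eq_class:
  assumes "Q \<in> L_surface" "p \<in> Q"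
  shows "Q = L_rel `` {p}"
proof -
  obtain r where "r \<in> L_region" "Q = L_rel `` {r}"
    using assms(1) by (auto simp: L_surface_def quotient_def)
  then show ?thesis
    using assms(2) equiv_class_eq[OF equiv_L_rel] by auto
qed

lemma L_class_self: "p \<in> L_region \<Longrightarrow> p \<in> L_rel `` {p}"
  using equiv_L_rel by (auto simp: equiv_def refl_on_def)

lemma L_surface_subset: "Q \<in> L_surface \<Longrightarrow> Q \<subseteq> L_region"
  by (auto simp: L_surface_def quotient_def L_rel_def)

lemma L_class_surface: "p \<in> L_region \<Longrightarrow> L_rel `` {p} \<in> L_surface"
  by (auto simp: L_surface_def quotient_def)

lemma L_glue_class: "(p, q) \<in> L_glue \<union> L_glue\<inverse> \<Longrightarrow> L_rel `` {p} = L_rel `` {q}"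
  using L_glue_subset equiv_class_eq[OF equiv_L_rel] by blast

section \<open>Closeness\<close>

lemma L_chain_trans:
  assumes "L_chain q r k" "L_chain p q l"
  shows "L_chain p r (l + k)"
  using assms
proof (induction rule: L_chain.induct)
  case (segment p' q' l' S r)
  then show ?case using L_chain.segment[of p q' "l + l'" S r] by (simp add: add.assoc)
qed (auto intro: L_chain.intros)

lemma L_chain_sym: "L_chain p q l \<Longrightarrow> L_chain q p l"
proof (induction rule: L_chain.induct)
  case (start p)
  then show ?case by (rule L_chain.start)
next
  case (segment p q l S r)
  then have "r \<in> L_region" by (auto simp: L_region_def)
  then have "L_chain r q (0 + dist r q)"
    using segment by (intro L_chain.segment[of _ _ _ S] L_chain.start)
  then show ?case
    using L_chain_trans[of q p l r "dist r q"] segment by (simp add: dist_commute add.commute)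
next
  case (identify p q l r)
  then have "(r, q) \<in> L_rel" "r \<in> L_region"
    using equivE[OF equiv_L_rel] by (auto dest: symD)
  then have "L_chain r q 0"
    by (blast intro: L_chain.intros)
  then show ?case
    using L_chain_trans[of q p l r 0] identify by simp
qed

text \<open>With an explicit chain in place of the infimum in \<open>L_dist\<close>, the triangle
  inequality is a concatenation.\<close>

definition near :: "(real \<times> real) set \<Rightarrow> (real \<times> real) set \<Rightarrow> real \<Rightarrow> bool" where
  "near P Q d \<longleftrightarrow> (\<exists>p\<in>P. \<exists>q\<in>Q. \<exists>l\<le>d. L_chain p q l)"

lemma near_sym: "near P Q d \<Longrightarrow> near Q P d"
  unfolding near_def by (blast intro: L_chain_sym)

lemma near_mono: "near P Q d \<Longrightarrow> d \<le> e \<Longrightarrow> near P Q e"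
  unfolding near_def by (meson order_trans)

lemma near_trans:
  assumes "near P Q d" "near Q R e" "Q \<in> L_surface"
  shows "near P R (d + e)"
proof -
  obtain p q l where 1: "p \<in> P" "q \<in> Q" "l \<le> d" "L_chain p q l"
    using assms(1) by (auto simp: near_def)
  obtain q' r k where 2: "q' \<in> Q" "r \<in> R" "k \<le> e" "L_chain q' r k"
    using assms(2) by (auto simp: near_def)
  have "(q, q') \<in> L_rel"
    using L_surface_eq_class[OF assms(3) 1(2)] 2(1) by auto
  then have "L_chain p r (l + k)"
    using 1 2 by (blast intro: L_chain_trans L_chain.identify)
  then show ?thesis
    using 1 2 unfolding near_def by (meson add_mono)
qed

lemma L_dist_le_near:
  assumes "near P Q d"
  shows "L_dist P Q \<le> d"
proof -
  obtain p q l where *: "p \<in> P" "q \<in> Q" "l \<le> d" "L_chain p q l"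
    using assms by (auto simp: near_def)
  have "L_dist P Q \<le> l"
    unfolding L_dist_def
    by (rule cInf_lower) (use * in \<open>auto intro!: bdd_belowI[of _ 0] dest: L_chain_nonneg\<close>)
  then show ?thesis using * by simp
qed

section \<open>The three squares\<close>

datatype tile = Base | East | North

fun corner :: "tile \<Rightarrow> real \<times> real" where
  "corner Base = (0, 0)" | "corner East = (1, 0)" | "corner North = (0, 1)"

fun hswap :: "tile \<Rightarrow> tile" where
  "hswap Base = East" | "hswap East = Base" | "hswap North = North"

fun vswap :: "tile \<Rightarrow> tile" where
  "vswap Base = North" | "vswap North = Base" | "vswap East = East"

text \<open>The flags \<open>b\<close>, \<open>c\<close> reflect the squares so that the direction of the geodesic has positive
  components; this respects the gluing because \<open>hswap\<close> and \<open>vswap\<close> are involutions. The parameter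
  \<open>x\<close> is the vertical and \<open>y\<close> the horizontal coordinate: level \<open>0\<close> of the continued fraction
  algorithm uses the basis \<open>e1 = (0, 1)\<close>, \<open>e2 = (1, 0)\<close>.\<close>

definition flip :: "bool \<Rightarrow> real \<Rightarrow> real" where
  "flip b a = (if b then a else 1 - a)"

definition tile_rep :: "bool \<Rightarrow> bool \<Rightarrow> real \<Rightarrow> real \<Rightarrow> tile \<Rightarrow> real \<times> real" where
  "tile_rep b c x y i = corner i + (flip b y, flip c x)"

definition tile_pt :: "bool \<Rightarrow> bool \<Rightarrow> real \<Rightarrow> real \<Rightarrow> tile \<Rightarrow> (real \<times> real) set" where
  "tile_pt b c x y i = L_rel `` {tile_rep b c x y i}"

lemma tile_rep_square:
  "\<exists>S\<in>L_squares. \<forall>x\<in>{0..1}. \<forall>y\<in>{0..1}. tile_rep b c x y i \<in> S"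
  by (cases i) (auto simp: tile_rep_def flip_def L_squares_def)

lemma tile_rep_region: "x \<in> {0..1} \<Longrightarrow> y \<in> {0..1} \<Longrightarrow> tile_rep b c x y i \<in> L_region"
  using tile_rep_square[of b c i] unfolding L_region_def by blast

lemma tile_pt_glueH: "y \<in> {0..1} \<Longrightarrow> tile_pt b c 1 y i = tile_pt b c 0 y (vswap i)"
  unfolding tile_pt_def
  by (cases i; cases c; cases b)
    (auto simp: tile_rep_def flip_def L_glue_iff intro!: L_glue_class)

lemma tile_pt_glueV: "x \<in> {0..1} \<Longrightarrow> tile_pt b c x 1 i = tile_pt b c x 0 (hswap i)"
  unfolding tile_pt_def
  by (cases i; cases c; cases b)
    (auto simp: tile_rep_def flip_def L_glue_iff intro!: L_glue_class)

lemma tile_pt_corner: "tile_pt b c 0 0 i = L_vertex"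
  unfolding tile_pt_def
  by (rule L_vertex_corners) (cases i; cases c; cases b; simp add: tile_rep_def flip_def)

lemma tile_pt_surface: "x \<in> {0..1} \<Longrightarrow> y \<in> {0..1} \<Longrightarrow> tile_pt b c x y i \<in> L_surface"
  unfolding tile_pt_def by (intro L_class_surface tile_rep_region)

lemma region_tile_rep:
  assumes "z \<in> L_region"
  shows "\<exists>x\<in>{0..1}. \<exists>y\<in>{0..1}. \<exists>i. z = tile_rep b c x y i"
proof -
  obtain i where i: "z - corner i \<in> {0..1} \<times> {0..1}"
  proof -
    have "z - corner Base \<in> {0..1} \<times> {0..1} \<or> z - corner East \<in> {0..1} \<times> {0..1} \<or>
      z - corner North \<in> {0..1} \<times> {0..1}"
      using assms by (auto simp: L_region_def L_squares_def)
    then show ?thesis using that[of Base] that[of East] that[of North] by argo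
  qed
  obtain a d where ad: "z - corner i = (a, d)" "a \<in> {0..1}" "d \<in> {0..1}"
    using i by auto
  then have "z = tile_rep b c (flip c d) (flip b a) i"
    by (auto simp: tile_rep_def flip_def algebra_simps)
  then show ?thesis
    using ad by (intro bexI[of _ "flip c d"] bexI[of _ "flip b a"] exI[of _ i]) (auto simp: flip_def)
qed

text \<open>The reflected half-open squares keep one side of each glued pair, so without the corner
  they form a fundamental domain.\<close>

lemma tile_rep_inj:
  assumes "(tile_rep b c x y i, tile_rep b c x' y' j) \<in> L_rel"
    and "x \<in> {0..<1}" "y \<in> {0..<1}" "x' \<in> {0..<1}" "y' \<in> {0..<1}" "(x, y) \<noteq> (0, 0)"
  shows "x = x' \<and> y = y' \<and> i = j"
proof -
  have corners: "tile_rep b c x y i \<notin> {0,1,2} \<times> {0,1,2}"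
    using assms(2-) by (cases i; cases b; cases c) (auto simp: tile_rep_def flip_def)
  \<comment> \<open>\<open>L_glue\<close> is directed from left or bottom sides to right or top
    sides; the opposite order is covered by exchanging the two points.\<close>
  have no_glue: False
    if "(tile_rep b c x y i, tile_rep b c x' y' j) \<in> L_glue"
      "x \<in> {0..<1}" "y \<in> {0..<1}" "x' \<in> {0..<1}" "y' \<in> {0..<1}" 
      "tile_rep b c x y i \<notin> {0,1,2} \<times> {0,1,2}"
    for x y i x' y' j
  proof -
    obtain p1 p2 q1 q2 where pq: "tile_rep b c x y i = (p1, p2)" "tile_rep b c x' y' j = (q1, q2)"
      by (meson surj_pair)
    have glue: "((p1, p2), (q1, q2)) \<in> L_glue"
      using that(1) pq by simp
    have b: "if b then q1 < 2 else 0 < p1" and c: "if c then q2 < 2 else 0 < p2"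
      using pq that(2-5) by (cases i; cases j; auto simp: tile_rep_def flip_def)+
    \<comment> \<open>Under \<open>b\<close> a point with first coordinate at least 1 lies in
      \<open>East\<close>, too low to be glued to the left side of \<open>North\<close> except at a
      corner; \<open>cq\<close> is the transposed fact.\<close>
    have bq: "b \<Longrightarrow> 1 \<le> q1 \<Longrightarrow> q2 < 1 \<or> q2 = 1 \<and> \<not> c \<and> x' = 0"
      and cq: "c \<Longrightarrow> 1 \<le> q2 \<Longrightarrow> q1 < 1 \<or> q1 = 1 \<and> \<not> b \<and> y' = 0"
      using pq that(2-5) by (cases j; auto simp: tile_rep_def flip_def split: if_splits)+
    show False
      using glue b c bq cq that(6) pq(1) unfolding L_glue_iff by (auto split: if_splits)
  qed
  have "tile_rep b c x y i = tile_rep b c x' y' j"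
    using L_rel_cases[OF assms(1)]
  proof (elim disjE UnE)
    assume "(tile_rep b c x y i, tile_rep b c x' y' j) \<in> L_glue"
    then show ?thesis using no_glue[OF _ assms(2-5) corners] by blast
  next
    assume "(tile_rep b c x y i, tile_rep b c x' y' j) \<in> L_glue\<inverse>"
    then have *: "(tile_rep b c x' y' j, tile_rep b c x y i) \<in> L_glue" by simp
    then have "tile_rep b c x' y' j \<notin> {0,1,2} \<times> {0,1,2}"
      using L_glue_corner[OF UnI1[OF *]] corners by argo
    then show ?thesis using no_glue[OF _ assms(4,5,2,3)] * by blast
  qed (use corners in auto)
  then show ?thesis
    using assms(2-5) by (cases i; cases j) (auto simp: tile_rep_def flip_def split: if_splits)
qed

section \<open>Pairs of permutations of three squares\<close>

lemma tile_cases3: "(i::tile) \<noteq> j \<Longrightarrow> i \<noteq> k \<Longrightarrow> j \<noteq> k \<Longrightarrow> l = i \<or> l = j \<or> l = k"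
  by (cases i; cases j; cases k; cases l; simp)

lemma UNIV_tile: "(UNIV :: tile set) = {Base, East, North}"
  using tile.exhaust by auto

instance tile :: finite
  by standard (simp add: UNIV_tile)

text \<open>Two permutations of three letters generate the symmetric group iff they do not commute.\<close>

definition generating :: "(tile \<Rightarrow> tile) \<Rightarrow> (tile \<Rightarrow> tile) \<Rightarrow> bool" where
  "generating H V \<longleftrightarrow> inj H \<and> inj V \<and> (\<exists>i. H (V i) \<noteq> V (H i))"

lemma tile_all: "(\<forall>i. Q i) \<longleftrightarrow> Q Base \<and> Q East \<and> Q North"
  by (metis tile.exhaust)

lemma tile_ex: "(\<exists>i. Q i) \<longleftrightarrow> Q Base \<or> Q East \<or> Q North"
  by (metis tile.exhaust)

lemma inj_tile: "inj H \<longleftrightarrow> H Base \<noteq> H East \<and> H Base \<noteq> H North \<and> H East \<noteq> H North"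
  unfolding inj_def tile_all by auto

lemma inj_tile_cases:
  assumes "inj f"
  shows "f Base = Base \<and> f East = East \<and> f North = North \<or>
    f Base = Base \<and> f East = North \<and> f North = East \<or>
    f Base = East \<and> f East = Base \<and> f North = North \<or>
    f Base = East \<and> f East = North \<and> f North = Base \<or>
    f Base = North \<and> f East = Base \<and> f North = East \<or>
    f Base = North \<and> f East = East \<and> f North = Base"
  using assms unfolding inj_tile by (cases "f Base"; cases "f East"; cases "f North"; simp)

text \<open>Parity: a permutation whose square is not the identity is a 3-cycle, so the other one is
  a transposition and their products are odd, hence involutions. In the last part \<open>H\<close>
  is a transposition, and a \<open>V\<close> fixing the same letter would commute with it.\<close>

lemma generating_cases:
  assumes "generating H V"
  shows "V \<circ> V = id \<or> (V \<circ> H) \<circ> (V \<circ> H) = id"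
    and "H \<circ> H = id \<or> V \<circ> V = id \<and> (V \<circ> H) \<circ> (V \<circ> H) = id \<and> (V \<circ> (H \<circ> H)) \<circ> (V \<circ> (H \<circ> H)) = id"
    and "H \<circ> H = id \<Longrightarrow> \<exists>f. H f = f \<and> V f \<noteq> f \<and> (\<forall>i. H i = i \<longrightarrow> i = f)"
proof -
  have H: "inj H" and V: "inj V"
    and nc: "\<not> (H (V Base) = V (H Base) \<and> H (V East) = V (H East) \<and> H (V North) = V (H North))"
    using assms by (auto simp: generating_def tile_ex)
  show "V \<circ> V = id \<or> (V \<circ> H) \<circ> (V \<circ> H) = id"
    using inj_tile_cases[OF H] inj_tile_cases[OF V] nc
    unfolding fun_eq_iff tile_all tile_ex by (elim disjE conjE; simp)
  show "H \<circ> H = id \<or> V \<circ> V = id \<and> (V \<circ> H) \<circ> (V \<circ> H) = id \<and> (V \<circ> (H \<circ> H)) \<circ> (V \<circ> (H \<circ> H)) = id"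
    using inj_tile_cases[OF H] inj_tile_cases[OF V] nc
    unfolding fun_eq_iff tile_all tile_ex by (elim disjE conjE; simp)
  show "\<exists>f. H f = f \<and> V f \<noteq> f \<and> (\<forall>i. H i = i \<longrightarrow> i = f)" if "H \<circ> H = id"
    using inj_tile_cases[OF H] inj_tile_cases[OF V] nc that
    unfolding fun_eq_iff tile_all tile_ex by (elim disjE conjE; simp)
qed

lemma inj_cube_or_involution:
  assumes "inj (H :: tile \<Rightarrow> tile)"
  shows "H \<circ> H = id \<or> (\<forall>i. H i \<noteq> i \<and> H (H (H i)) = i)"
  using assms unfolding inj_tile fun_eq_iff tile_all
  by (cases "H Base"; cases "H East"; cases "H North"; simp)

lemma funpow_involution:
  assumes "H \<circ> H = id"
  shows "(H ^^ n) i = (if even n then i else H i)"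
proof (induction n)
  case (Suc n)
  then show ?case using assms by (auto simp: fun_eq_iff)
qed simp

text \<open>\<open>H\<close> commutes with its own powers, so it commutes with
  \<open>V \<circ> (H ^^ m)\<close> only if it commutes with \<open>V\<close>.\<close>

lemma generating_step:
  assumes "generating H V"
  shows "generating (V \<circ> (H ^^ m)) H"
proof -
  obtain i where i: "H (V i) \<noteq> V (H i)"
    using assms by (auto simp: generating_def)
  have "inj (H ^^ m)"
    using assms by (simp add: generating_def inj_fn)
  then obtain j where "i = (H ^^ m) j"
    by (metis finite_UNIV_inj_surj finite_class.finite_UNIV surj_def)
  then have "(V \<circ> (H ^^ m)) (H j) \<noteq> H ((V \<circ> (H ^^ m)) j)"
    using i by (simp add: funpow_swap1[symmetric])
  then show ?thesis
    using assms \<open>inj (H ^^ m)\<close> by (auto simp: generating_def inj_compose)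
qed

text \<open>\<open>H\<close> is a 3-cycle, so only \<open>m mod 3\<close> matters, and all three
  products are transpositions.\<close>

lemma generating_not_involution:
  assumes "generating H V" "H \<circ> H \<noteq> id"
  shows "(V \<circ> (H ^^ m)) \<circ> (V \<circ> (H ^^ m)) = id"
proof -
  have 3: "H (H (H i)) = i" for i
    using inj_cube_or_involution[of H] assms by (auto simp: generating_def)
  have pow: "H ^^ m = H ^^ (m mod 3)"
  proof -
    have "H ^^ (3 * n) = id" for n
      by (induction n) (auto simp: fun_eq_iff 3 eval_nat_numeral)
    have "H ^^ m = H ^^ (m mod 3 + 3 * (m div 3))"
      by (simp only: mod_mult_div_eq)
    also have "\<dots> = H ^^ (m mod 3)"
      by (simp only: funpow_add \<open>\<And>n. H ^^ (3 * n) = id\<close> comp_id)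
    finally show ?thesis .
  qed
  have "m mod 3 = 0 \<or> m mod 3 = 1 \<or> m mod 3 = 2" by linarith
  with pow obtain r where "H ^^ m = H ^^ r" "r = 0 \<or> r = 1 \<or> r = 2"
    by (rule that)
  then have "H ^^ m = id \<or> H ^^ m = H \<or> H ^^ m = H \<circ> H"
    by (auto simp: eval_nat_numeral)
  moreover have "V \<circ> V = id \<and> (V \<circ> H) \<circ> (V \<circ> H) = id \<and> (V \<circ> (H \<circ> H)) \<circ> (V \<circ> (H \<circ> H)) = id"
    using generating_cases(2)[OF assms(1)] assms(2) by simp
  ultimately show ?thesis by auto
qed

lemma generating_involution_not:
  assumes "generating H V" "V \<circ> V \<noteq> id"
  shows "(V \<circ> H) \<circ> (V \<circ> H) = id"
  using generating_cases(1)[OF assms(1)] assms(2) by simp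

lemma generating_involution_fixpoint:
  assumes "generating H V" "H \<circ> H = id"
  obtains f where "H f = f" "V f \<noteq> f" "\<And>i. H i = i \<Longrightarrow> i = f"
proof -
  show ?thesis using generating_cases(3)[OF assms] that by blast
qed

section \<open>Tilings by parallelograms\<close>

text \<open>The point \<open>P x y i\<close> lies in parallelogram \<open>i\<close> at \<open>x e1 + y e2\<close>, where \<open>e1 = (q, p)\<close> and
  \<open>e2 = (q', p')\<close> form a lattice basis (of either orientation), and the direction of the geodesic is
  \<open>X e1 + Y e2\<close>. The bound in \<open>P_near\<close> is the \<open>l\<^sup>1\<close> norm of the displacement, which is additive
  along straight lines.\<close>

locale tiled =
  fixes \<gamma> :: "real \<Rightarrow> (real \<times> real) set" and w :: "(real \<times> real) set"
    and P :: "real \<Rightarrow> real \<Rightarrow> tile \<Rightarrow> (real \<times> real) set"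
    and H V :: "tile \<Rightarrow> tile" and X Y q q' p p' :: real
  assumes X_pos: "0 < X" and Y_pos: "0 < Y"
    and gen: "generating H V"
    and glueH: "y \<in> {0..1} \<Longrightarrow> P 1 y i = P 0 y (H i)"
    and glueV: "x \<in> {0..1} \<Longrightarrow> P x 1 i = P x 0 (V i)"
    and P_vertex: "P 0 0 i = w"
    and P_surface: "x \<in> {0..1} \<Longrightarrow> y \<in> {0..1} \<Longrightarrow> P x y i \<in> L_surface"
    and P_onto: "Q \<in> L_surface \<Longrightarrow> \<exists>x\<in>{0..<1}. \<exists>y\<in>{0..<1}. \<exists>i. Q = P x y i"
    and P_inj: "P x y i = P x' y' j \<Longrightarrow> P x y i \<noteq> w \<Longrightarrow> x \<in> {0..<1} \<Longrightarrow> y \<in> {0..<1} \<Longrightarrow>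
      x' \<in> {0..<1} \<Longrightarrow> y' \<in> {0..<1} \<Longrightarrow> x = x' \<and> y = y' \<and> i = j"
    and P_near: "x \<in> {0..1} \<Longrightarrow> y \<in> {0..1} \<Longrightarrow> x' \<in> {0..1} \<Longrightarrow> y' \<in> {0..1} \<Longrightarrow>
      near (P x y i) (P x' y' i)
        (\<bar>(x - x') * q + (y - y') * q'\<bar> + \<bar>(x - x') * p + (y - y') * p'\<bar>)"
    and P_flow: "0 \<le> t \<Longrightarrow> \<gamma> t = P x y i \<Longrightarrow> x \<in> {0..<1} \<Longrightarrow> y \<in> {0..<1} \<Longrightarrow> 0 \<le> s \<Longrightarrow>
      x + s * X \<le> 1 \<Longrightarrow> y + s * Y \<le> 1 \<Longrightarrow> \<gamma> (t + s) = P (x + s * X) (y + s * Y) i"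
    and surface: "0 \<le> t \<Longrightarrow> \<gamma> t \<in> L_surface"
    and no_vertex: "0 \<le> t \<Longrightarrow> \<gamma> t \<noteq> w"
    and q_nonneg: "0 \<le> q" "0 \<le> q'"
    and det: "\<bar>q * p' - q' * p\<bar> = 1"
begin

text \<open>Continuation of \<open>P\<close> to the right along the cylinder in direction \<open>e1\<close>; only for \<open>x \<ge> 0\<close>.\<close>

definition E :: "real \<Rightarrow> real \<Rightarrow> tile \<Rightarrow> (real \<times> real) set" where
  "E x y i = P (frac x) y ((H ^^ nat \<lfloor>x\<rfloor>) i)"

lemma E_unit: "x \<in> {0..<1} \<Longrightarrow> E x y i = P x y i"
  by (simp add: E_def frac_eq floor_eq_iff)

text \<open>At \<open>x = real k + 1\<close> the floor has already jumped to the next cell, and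
  \<open>glueH\<close> reconciles the two descriptions. Closed cells are what \<open>P_near\<close>
  and \<open>P_flow\<close> can be applied to.\<close>

lemma E_cell:
  assumes "real k \<le> x" "x \<le> real k + 1" "y \<in> {0..1}"
  shows "E x y i = P (x - real k) y ((H ^^ k) i)"
proof (cases "x = real k + 1")
  case True
  then have floor: "nat \<lfloor>x\<rfloor> = Suc k" and frac: "frac x = 0"
    by (simp_all add: nat_add_distrib frac_def)
  have "E x y i = P 0 y (H ((H ^^ k) i))"
    unfolding E_def floor frac by simp
  then show ?thesis
    using True glueH[OF assms(3), of "(H ^^ k) i"] by simp
next
  case False
  then have "\<lfloor>x\<rfloor> = int k"
    using assms by (intro floor_unique) auto
  then show ?thesis by (simp add: E_def frac_def)
qed

lemma E_add:
  assumes "0 \<le> x"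
  shows "E (x + real k) y i = E x y ((H ^^ k) i)"
proof -
  have floor: "\<lfloor>x + real k\<rfloor> = \<lfloor>x\<rfloor> + int k"
    by linarith
  then have "nat \<lfloor>x + real k\<rfloor> = nat \<lfloor>x\<rfloor> + k"
    using assms by (simp add: nat_add_distrib)
  moreover have "frac (x + real k) = frac x"
    using floor by (simp add: frac_def)
  ultimately show ?thesis
    by (simp add: E_def funpow_add)
qed

lemma E_surface: "0 \<le> x \<Longrightarrow> y \<in> {0..1} \<Longrightarrow> E x y i \<in> L_surface"
  unfolding E_def by (intro P_surface) (auto simp: frac_lt_1 less_imp_le)

lemma E_near_le:
  assumes "0 \<le> x" "x \<le> x'" "y \<in> {0..1}" "y' \<in> {0..1}"
  shows "near (E x y i) (E x' y' i)
    (\<bar>(x - x') * q + (y - y') * q'\<bar> + \<bar>(x - x') * p + (y - y') * p'\<bar>)"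
proof -
  obtain n where "x' - real_of_int \<lfloor>x\<rfloor> - 1 < real n"
    using reals_Archimedean2 by blast
  then have "x' < real_of_int \<lfloor>x\<rfloor> + 1 + real n"
    by linarith
  \<comment> \<open>Induction on a bound for the number of cell walls between \<open>x\<close> and
    \<open>x'\<close>; the segment is cut at the first wall.\<close>
  then show ?thesis
    using assms(1-3)
  proof (induction n arbitrary: x y)
    case (0 x y)
    define k where "k = nat \<lfloor>x\<rfloor>"
    have "real k = of_int \<lfloor>x\<rfloor>"
      using 0 by (simp add: k_def)
    then have k: "real k \<le> x" "x' \<le> real k + 1"
      using 0 by linarith+
    have "E x y i = P (x - real k) y ((H ^^ k) i)" "E x' y' i = P (x' - real k) y' ((H ^^ k) i)"
      by (intro E_cell; use k 0 assms(4) in auto)+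
    then show ?case
      using P_near[of "x - real k" y "x' - real k" y' "(H ^^ k) i"] k 0 assms(4) by simp
  next
    case (Suc n x y)
    define k where "k = nat \<lfloor>x\<rfloor>"
    have k: "real k = of_int \<lfloor>x\<rfloor>"
      using Suc.prems by (simp add: k_def)
    then have kx: "real k \<le> x" "x < real k + 1"
      by linarith+
    show ?case
    proof (cases "x' < real k + 1")
      case True
      then show ?thesis
        by (intro Suc.IH) (use Suc.prems k in auto)
    next
      case False
      define x1 where "x1 = real k + 1"
      define l where "l = (x1 - x) / (x' - x)"
      define y1 where "y1 = y + l * (y' - y)"
      have xx: "x < x'" using False kx by simp
      have l: "0 \<le> l" "l \<le> 1"
        using False kx by (auto simp: l_def x1_def divide_simps)
      have lx: "x1 - x = l * (x' - x)"
        using xx by (simp add: l_def)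
      have "y1 = (1 - l) * y + l * y'" by (simp add: y1_def algebra_simps)
      moreover have "(1 - l) * y \<le> 1 - l" "l * y' \<le> l" "0 \<le> (1 - l) * y" "0 \<le> l * y'"
        using l Suc.prems(4) assms(4) mult_left_le[of y "1 - l"] mult_left_le[of y' l] by auto
      ultimately have y1: "y1 \<in> {0..1}" by simp
      have "E x y i = P (x - real k) y ((H ^^ k) i)" "E x1 y1 i = P (x1 - real k) y1 ((H ^^ k) i)"
        by (intro E_cell; use kx y1 Suc.prems in \<open>auto simp: x1_def\<close>)+
      then have 1: "near (E x y i) (E x1 y1 i)
          (\<bar>(x - x1) * q + (y - y1) * q'\<bar> + \<bar>(x - x1) * p + (y - y1) * p'\<bar>)"
        using P_near[of "x - real k" y "x1 - real k" y1 "(H ^^ k) i"] kx Suc.prems y1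
        by (simp add: x1_def diff_diff_eq)
      have "\<lfloor>x1\<rfloor> = \<lfloor>x\<rfloor> + 1"
        using k by (simp add: x1_def)
      then have 2: "near (E x1 y1 i) (E x' y' i)
          (\<bar>(x1 - x') * q + (y1 - y') * q'\<bar> + \<bar>(x1 - x') * p + (y1 - y') * p'\<bar>)"
        using False Suc.prems y1 by (intro Suc.IH) (auto simp: x1_def)
      \<comment> \<open>The cut point lies on the segment, so both displacements are multiples of
        the whole, by \<open>l\<close> and \<open>1 - l\<close>, and the two bounds add up
        exactly.\<close>
      have split: "\<bar>(x - x1) * a + (y - y1) * b\<bar> + \<bar>(x1 - x') * a + (y1 - y') * b\<bar> =
        \<bar>(x - x') * a + (y - y') * b\<bar>" for a b
      proof -
        have d: "x - x1 = l * (x - x')" "y - y1 = l * (y - y')"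
          "x1 - x' = (1 - l) * (x - x')" "y1 - y' = (1 - l) * (y - y')"
          using lx by (auto simp: y1_def algebra_simps)
        have "(x - x1) * a + (y - y1) * b = l * ((x - x') * a + (y - y') * b)"
          unfolding d by (simp add: algebra_simps)
        moreover have "(x1 - x') * a + (y1 - y') * b = (1 - l) * ((x - x') * a + (y - y') * b)"
          unfolding d by (simp add: algebra_simps)
        moreover have "\<bar>l * c\<bar> + \<bar>(1 - l) * c\<bar> = \<bar>c\<bar>" for c
          unfolding abs_mult using l by (simp add: distrib_right[symmetric])
        ultimately show ?thesis by (simp only:)
      qed
      have 3: "E x1 y1 i \<in> L_surface"
        by (rule E_surface) (use y1 in \<open>auto simp: x1_def\<close>)
      show ?thesis
        by (rule near_mono[OF near_trans[OF 1 2 3]])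
          (use split[of q q'] split[of p p'] in linarith)
    qed
  qed
qed

lemma E_near:
  assumes "0 \<le> x" "0 \<le> x'" "y \<in> {0..1}" "y' \<in> {0..1}"
  shows "near (E x y i) (E x' y' i)
    (\<bar>(x - x') * q + (y - y') * q'\<bar> + \<bar>(x - x') * p + (y - y') * p'\<bar>)"
proof (cases "x \<le> x'")
  case True
  then show ?thesis using assms E_near_le by blast
next
  case False
  have "\<bar>(x - x') * a + (y - y') * b\<bar> = \<bar>(x' - x) * a + (y' - y) * b\<bar>" for a b
    by (simp add: abs_if algebra_simps)
  then show ?thesis
    using near_sym[OF E_near_le[of x' x y' y i]] assms False by simp
qed

lemma E_flow:
  assumes "0 \<le> t" "\<gamma> t = E x y i" "0 \<le> x" "y \<in> {0..<1}" "0 \<le> s" "y + s * Y \<le> 1"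
  shows "\<gamma> (t + s) = E (x + s * X) (y + s * Y) i"
proof -
  obtain n where "x + s * X - real_of_int \<lfloor>x\<rfloor> - 1 < real n"
    using reals_Archimedean2 by blast
  then have "x + s * X < real_of_int \<lfloor>x\<rfloor> + 1 + real n"
    by linarith
  then show ?thesis
    using assms
  proof (induction n arbitrary: x y t s)
    case (0 x y t s)
    define k where "k = nat \<lfloor>x\<rfloor>"
    have "real k = of_int \<lfloor>x\<rfloor>"
      using 0 by (simp add: k_def)
    then have k: "real k \<le> x" "x < real k + 1" "x + s * X \<le> real k + 1"
      using 0 by linarith+
    have sX: "0 \<le> s * X" "0 \<le> s * Y" using 0 X_pos Y_pos by simp_all
    have "E x y i = P (x - real k) y ((H ^^ k) i)"
      "E (x + s * X) (y + s * Y) i = P (x + s * X - real k) (y + s * Y) ((H ^^ k) i)"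
      by (intro E_cell; use k 0 sX in auto)+
    then show ?case
      using P_flow[of t "x - real k" y "(H ^^ k) i" s] k 0 sX by (simp add: algebra_simps)
  next
    case (Suc n x y t s)
    define k where "k = nat \<lfloor>x\<rfloor>"
    have k: "real k = of_int \<lfloor>x\<rfloor>"
      using Suc.prems by (simp add: k_def)
    then have kx: "real k \<le> x" "x < real k + 1"
      by linarith+
    show ?case
    proof (cases "x + s * X < real k + 1")
      case True
      then show ?thesis
        by (intro Suc.IH) (use Suc.prems k in auto)
    next
      case False
      define s1 where "s1 = (real k + 1 - x) / X"
      have s1: "0 < s1" "s1 * X = real k + 1 - x"
        using kx X_pos by (auto simp: s1_def)
      then have "s1 * X \<le> s * X" using False by simp
      then have ss: "s1 \<le> s" using X_pos by simp
      then have "s1 * Y \<le> s * Y" "0 < s1 * Y" using Y_pos s1 by (simp_all add: mult_right_mono)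
      then have y1: "y + s1 * Y \<in> {0..1}" "0 \<le> y + s1 * Y" using Suc.prems by auto
      have E1: "E x y i = P (x - real k) y ((H ^^ k) i)"
        "E (real k + 1) (y + s1 * Y) i = P 1 (y + s1 * Y) ((H ^^ k) i)"
        using E_cell[of k x y i] E_cell[of k "real k + 1" "y + s1 * Y" i] kx Suc.prems y1 by auto
      then have 1: "\<gamma> (t + s1) = E (x + s1 * X) (y + s1 * Y) i"
        using P_flow[of t "x - real k" y "(H ^^ k) i" s1] kx Suc.prems s1 y1 by simp
      \<comment> \<open>A path ending on the wall may have height 1 there, which the induction
        hypothesis does not admit; a path that continues is still below height 1.\<close>
      show ?thesis
      proof (cases "s1 = s")
        case True
        then show ?thesis using 1 by simp
      next
        case False
        then have "s1 * Y < s * Y" using ss Y_pos by simp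
        moreover have "\<lfloor>x + s1 * X\<rfloor> = \<lfloor>x\<rfloor> + 1"
          using k s1 by simp
        moreover from this
        have "x + s1 * X + (s - s1) * X < real_of_int \<lfloor>x + s1 * X\<rfloor> + 1 + real n"
          using Suc.prems(1) by (simp add: algebra_simps)
        moreover have "y + s1 * Y + (s - s1) * Y \<le> 1"
          using Suc.prems by (simp add: algebra_simps)
        moreover have "0 \<le> x + s1 * X" "y + s1 * Y \<in> {0..<1}"
          using calculation Suc.prems y1 s1 kx by auto
        ultimately have "\<gamma> (t + s1 + (s - s1)) =
          E (x + s1 * X + (s - s1) * X) (y + s1 * Y + (s - s1) * Y) i"
          using Suc.prems(2) 1 s1(1) ss
          by (intro Suc.IH[where x = "x + s1 * X" and y = "y + s1 * Y" and t = "t + s1"]) auto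
        then show ?thesis by (simp add: algebra_simps)
      qed
    qed
  qed
qed

lemma P_vertex_corners: "P 1 0 i = w" "P 0 1 i = w" "P 1 1 i = w"
  using glueH[of 0 i] glueH[of 1 i] glueV[of 0 i] glueV[of 0 "H i"] by (auto simp: P_vertex)

lemma funpow_H_surj: "\<exists>j. (H ^^ k) j = i"
proof -
  have "inj (H ^^ k)"
    using gen by (simp add: generating_def inj_fn)
  then show ?thesis
    by (metis finite_UNIV_inj_surj finite_class.finite_UNIV surj_def)
qed

text \<open>A continued fraction step: the basis becomes \<open>m e1 + e2\<close>,
  \<open>e1\<close>. The point \<open>x (m e1 + e2) + y e1\<close> is
  \<open>(m x + y) e1 + x e2\<close>, and the direction is
  \<open>Y (m e1 + e2) + (X - m Y) e1\<close>. The new first vector crosses \<open>m\<close> walls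
  and then a top side, hence \<open>V \<circ> (H ^^ m)\<close>; the second crosses one wall, hence
  \<open>H\<close>.\<close>

lemma step:
  assumes m: "real m * Y < X"
  shows "tiled \<gamma> w (\<lambda>x y i. E (real m * x + y) x i) (V \<circ> (H ^^ m)) H Y (X - real m * Y)
    (real m * q + q') q (real m * p + p') p"
proof
  show "0 < Y" "0 < X - real m * Y" using Y_pos m by auto
  show "generating (V \<circ> (H ^^ m)) H" using gen by (rule generating_step)
  show "E (real m * 1 + y) 1 i = E (real m * 0 + y) 0 ((V \<circ> (H ^^ m)) i)"
    if "y \<in> {0..1}" for y i
  proof -
    have "E (real m * 1 + y) 1 i = P y 1 ((H ^^ m) i)"
      using E_cell[of m "real m + y" 1 i] that by simp
    also have "\<dots> = P y 0 (V ((H ^^ m) i))"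
      by (rule glueV) (use that in auto)
    also have "\<dots> = E y 0 (V ((H ^^ m) i))"
      using E_cell[of 0 y 0] that by simp
    finally show ?thesis by simp
  qed
  show "E (real m * x + 1) x i = E (real m * x + 0) x (H i)" if "x \<in> {0..1}" for x i
    using E_add[of "real m * x" 1 x i] that by simp
  show "E (real m * 0 + 0) 0 i = w" for i
    by (simp add: E_unit P_vertex)
  show "E (real m * x + y) x i \<in> L_surface" if "x \<in> {0..1}" "y \<in> {0..1}" for x y i
    using that by (intro E_surface) auto
  show "\<exists>x\<in>{0..<1}. \<exists>y\<in>{0..<1}. \<exists>i. Q = E (real m * x + y) x i" if Q: "Q \<in> L_surface" for Q
  proof -
    obtain x y i where xy: "x \<in> {0..<1}" "y \<in> {0..<1}" "Q = P x y i"
      using P_onto[OF Q] by blast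
    \<comment> \<open>The new second coordinate is \<open>x - m y\<close> up to whole turns. It may
      be negative, so \<open>k\<close> turns are added and compensated by starting from the letter
      \<open>j\<close>.\<close>
    define z where "z = x - real m * y"
    define k where "k = nat (- \<lfloor>z\<rfloor>)"
    have "0 \<le> real m * y" using xy by simp
    moreover have "x < 1" using xy by simp
    ultimately have "z < 1"
      unfolding z_def by linarith
    then have "\<lfloor>z\<rfloor> \<le> 0" by linarith
    then have k: "real k = - of_int \<lfloor>z\<rfloor>" by (simp add: k_def)
    obtain j where j: "(H ^^ k) j = i" using funpow_H_surj by blast
    have eq: "real m * y + frac z = x + real k"
      by (simp add: frac_def k z_def)
    have Q_eq: "Q = E (real m * y + frac z) y j"
      unfolding eq using E_add[of x k y j] xy j E_unit by simp
    have "frac z \<in> {0..<1}" using frac_lt_1[of z] by simp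
    with xy(2) Q_eq show ?thesis by blast
  qed
  show "x = x' \<and> y = y' \<and> i = j"
    if "E (real m * x + y) x i = E (real m * x' + y') x' j" "E (real m * x + y) x i \<noteq> w"
      "x \<in> {0..<1}" "y \<in> {0..<1}" "x' \<in> {0..<1}" "y' \<in> {0..<1}" for x y i x' y' j
  proof -
    let ?z = "real m * x + y" and ?z' = "real m * x' + y'"
    have eq: "frac ?z = frac ?z'" "x = x'" "(H ^^ nat \<lfloor>?z\<rfloor>) i = (H ^^ nat \<lfloor>?z'\<rfloor>) j"
      using P_inj[of "frac ?z" x "(H ^^ nat \<lfloor>?z\<rfloor>) i" "frac ?z'" x' "(H ^^ nat \<lfloor>?z'\<rfloor>) j"] that
      by (auto simp: E_def frac_lt_1)
    then have "y - y' = of_int (\<lfloor>?z\<rfloor> - \<lfloor>?z'\<rfloor>)"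
      by (simp add: frac_def)
    moreover have "\<bar>y - y'\<bar> < 1" using that(3-6) by auto
    ultimately have "\<bar>real_of_int (\<lfloor>?z\<rfloor> - \<lfloor>?z'\<rfloor>)\<bar> < 1" by simp
    then have "\<lfloor>?z\<rfloor> = \<lfloor>?z'\<rfloor>" by linarith
    moreover from this have "y = y'" using \<open>y - y' = _\<close> by simp
    moreover have "inj (H ^^ nat \<lfloor>?z\<rfloor>)"
      using gen by (simp add: generating_def inj_fn)
    ultimately show ?thesis
      using eq by (auto dest: injD)
  qed
  show "near (E (real m * x + y) x i) (E (real m * x' + y') x' i)
      (\<bar>(x - x') * (real m * q + q') + (y - y') * q\<bar> + \<bar>(x - x') * (real m * p + p') + (y - y') * p\<bar>)"
    if "x \<in> {0..1}" "y \<in> {0..1}" "x' \<in> {0..1}" "y' \<in> {0..1}" for x y x' y' i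
    using E_near[of "real m * x + y" "real m * x' + y'" x x' i] that
    by (simp add: algebra_simps)
  show "\<gamma> (t + s) = E (real m * (x + s * Y) + (y + s * (X - real m * Y))) (x + s * Y) i"
    if "0 \<le> t" "\<gamma> t = E (real m * x + y) x i" "x \<in> {0..<1}" "y \<in> {0..<1}" "0 \<le> s"
      "x + s * Y \<le> 1" for t x y i s
    using E_flow[of t "real m * x + y" x i s] that by (simp add: algebra_simps)
  show "\<bar>(real m * q + q') * p - q * (real m * p + p')\<bar> = 1"
    using det by (simp add: algebra_simps abs_minus_commute)
qed (use surface no_vertex q_nonneg in auto)

end

section \<open>Returns to the bottom sides\<close>

text \<open>A crossing that starts from \<open>(x n, i n)\<close> passes the left sides of the
  letters \<open>(H ^^ l) (i n)\<close> with \<open>real l \<le> x n + R\<close>. As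
  \<open>H\<close> is an involution, the letter only sees the parity of the number of walls. The
  proof supposes that \<open>j\<close> is never met and separates the fixed letter \<open>f\<close>
  of \<open>H\<close> from the two others.\<close>

lemma return_visits:
  fixes x :: "nat \<Rightarrow> real" and i :: "nat \<Rightarrow> tile"
  assumes gen: "generating H V" and H2: "H \<circ> H = id" and V2: "V \<circ> V = id \<or> 2 \<le> R"
    and R: "1 \<le> R" and c: "\<And>z::int. c \<le> \<bar>R - of_int z\<bar>" and N: "1 \<le> c * real N"
    and x: "\<And>n. x n \<in> {0..<1}" and x_Suc: "\<And>n. x (Suc n) = frac (x n + R)"
    and i_Suc: "\<And>n. i (Suc n) = V ((H ^^ nat \<lfloor>x n + R\<rfloor>) (i n))"
  shows "\<exists>n\<le>N + 1. \<exists>l. 1 \<le> l \<and> real l \<le> x n + R \<and> (H ^^ l) (i n) = j"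
proof (rule ccontr)
  assume contra: "\<not> ?thesis"
  then have none: "(H ^^ l) (i n) \<noteq> j" if "n \<le> N + 1" "1 \<le> l" "real l \<le> x n + R" for n l
    using that by blast
  have "N \<noteq> 0" using N by (intro notI) simp
  have HH: "H (H k) = k" for k using H2 by (simp add: fun_eq_iff)
  obtain f where f: "H f = f" "V f \<noteq> f" "\<And>k. H k = k \<Longrightarrow> k = f"
    using generating_involution_fixpoint[OF gen H2] by blast
  have inj: "inj H" "inj V" using gen by (auto simp: generating_def)
  have one: "H (i n) \<noteq> j" if "n \<le> N + 1" for n
    using none[of n 1] that x[of n] R by simp
  define m where "m n = nat \<lfloor>x n + R\<rfloor>" for n
  have m_le: "real (m n) \<le> x n + R" "x n + R < real (m n) + 1" for n
    using x[of n] R unfolding m_def by (auto simp: of_nat_nat)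
  have m_ge: "1 \<le> m n" for n
    using m_le[of n] x[of n] R by auto
  have i_Suc': "i (Suc n) = V (if even (m n) then i n else H (i n))" for n
    using i_Suc[of n] by (simp add: m_def[symmetric] funpow_involution[OF H2])
  show False
  proof (cases "j = f")
    case True
    have nf: "i n \<noteq> f" if "n \<le> N + 1" for n
      using one[OF that] f(1) True by auto
    \<comment> \<open>\<open>g n\<close> is the letter whose top side is crossed. It is not
      \<open>f\<close>, and not the preimage \<open>a\<close> of \<open>f\<close> because the next
      letter is not \<open>f\<close> either; a single letter remains.\<close>
    define g where "g n = (if even (m n) then i n else H (i n))" for n
    obtain a where a: "V a = f"
      using inj(2) by (metis finite_UNIV_inj_surj finite_class.finite_UNIV surj_def)
    have "a \<noteq> f" using a f(2) by auto
    then have Ha: "H a \<noteq> a" "H a \<noteq> f" using f HH by metis+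
    have g: "g n = H a" if "n \<le> N" for n
    proof -
      have "g n \<noteq> f" using nf[of n] that f(1) HH by (metis g_def le_Suc_eq Suc_eq_plus1)
      moreover have "g n \<noteq> a" using nf[of "Suc n"] that a i_Suc'[of n] by (auto simp: g_def)
      ultimately show ?thesis using tile_cases3[of a f "H a" "g n"] \<open>a \<noteq> f\<close> Ha by auto
    qed
    then have iV: "i (Suc n) = V (H a)" if "n \<le> N" for n
      using that i_Suc'[of n] by (simp add: g_def)
    \<comment> \<open>Equal letters before and after \<open>H ^^ m n\<close> fix the parity of
      \<open>m n\<close>, and two of these numbers differ by at most 1.\<close>
    have m_const: "m n = m 1" if n: "1 \<le> n" "n \<le> N" for n
    proof -
      have "even (m n) \<longleftrightarrow> even (m 1)"
      proof -
        obtain n' where n': "n = Suc n'" using n by (cases n) auto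
        have "i n = V (H a)" "i 1 = V (H a)"
          using iV[of n'] iV[of 0] n n' by auto
        moreover have "V (H a) \<noteq> f" using a Ha inj by (metis injD)
        then have "H (V (H a)) \<noteq> V (H a)" using f by blast
        moreover have "g n = H a" "g 1 = H a" using g n \<open>N \<noteq> 0\<close> by auto
        ultimately show ?thesis by (auto simp: g_def split: if_splits)
      qed
      moreover have "\<bar>real (m n) - real (m 1)\<bar> < 2"
        using m_le[of n] m_le[of 1] x[of n] x[of 1] by auto
      then have "m n = m 1 \<or> m n = Suc (m 1) \<or> m 1 = Suc (m n)" by linarith
      ultimately show ?thesis by auto
    qed
    \<comment> \<open>With a constant number of turns the rotation is a mere translation:
      \<open>N\<close> equal drifts stay inside the unit interval, against the choice of
      \<open>N\<close>.\<close>
    have "x (Suc n) = x 1 + real n * (R - real (m 1))" if "n \<le> N" for n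
      using that
    proof (induction n)
      case (Suc n)
      have "x (Suc (Suc n)) = x (Suc n) + R - real (m (Suc n))"
        using x_Suc[of "Suc n"] m_le[of "Suc n"] x[of "Suc n"] R
        by (simp add: frac_def m_def)
      then show ?case
        using Suc m_const[of "Suc n"] by (simp add: algebra_simps)
    qed simp
    from this[of N] have "\<bar>real N * (R - real (m 1))\<bar> < 1"
      using x[of 1] x[of "Suc N"] by auto
    moreover have "real N * c \<le> real N * \<bar>R - real (m 1)\<bar>"
      using c[of "int (m 1)"] by (intro mult_left_mono) auto
    ultimately show False
      using N by (simp add: abs_mult mult.commute)
  next
    case False
    then have j: "H j \<noteq> j" "H j \<noteq> f" using f HH by metis+
    \<comment> \<open>A crossing that starts at \<open>H j\<close> would meet \<open>j\<close> at
      its first wall.\<close>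
    have i_cases: "i n = f \<or> i n = j" if "n \<le> N + 1" for n
      using one[OF that] HH tile_cases3[of f j "H j" "i n"] j False by metis
    have from_f: "i (Suc n) = V f" if "i n = f" for n
      using that i_Suc'[of n] f(1) by simp
    have N1: "0 \<le> N + 1" "Suc 0 \<le> N + 1" "Suc (Suc 0) \<le> N + 1" using \<open>N \<noteq> 0\<close> by auto
    \<comment> \<open>The second wall would lead from \<open>j\<close> back to
      \<open>j\<close>.\<close>
    have two: "x n + R < 2" if "n \<le> N + 1" "i n = j" for n
      using none[of n 2] that HH by (force simp: eval_nat_numeral)
    have from_j: "i (Suc n) = V (H j)" if "n \<le> N + 1" "i n = j" for n
    proof -
      have "m n = 1" using two[OF that] m_le[of n] m_ge[of n] by linarith
      then show ?thesis using i_Suc'[of n] that by simp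
    qed
    have Vf: "V f = j" if "n \<le> N" "i n = f" for n
      using i_cases[of "Suc n"] from_f[OF that(2)] that f(2) by auto
    show False
    proof (cases "V \<circ> V = id")
      case True
      then have VV: "V (V k) = k" for k by (simp add: fun_eq_iff)
      \<comment> \<open>An involution that moves \<open>f\<close> exchanges it with \<open>j\<close>
        or with \<open>H j\<close> and fixes the remaining letter.\<close>
      have VHj: "V (H j) = f \<or> V (H j) = H j"
        using VV f(2) False j tile_cases3[of f j "H j"] by metis
      consider "i 0 = f" | "i 0 = j" using i_cases[of 0] by auto
      then show False
      proof cases
        case 1
        then have "V f = j" using Vf[of 0] by simp
        then have "V (H j) \<noteq> f" using VV j(1) by metis
        then have "V (H j) = H j" using VHj by simp
        then have "i (Suc (Suc 0)) = H j"
          using from_j[of "Suc 0"] from_f[OF 1] \<open>V f = j\<close> N1 by simp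
        then show False using one[OF N1(3)] HH by simp
      next
        case 2
        then have i1: "i (Suc 0) = V (H j)" using from_j[of 0] by simp
        then have "V (H j) \<noteq> H j" using one[OF N1(2)] HH by metis
        then have "V (H j) = f" using VHj by simp
        then have "i (Suc (Suc 0)) = H j"
          using from_f[of "Suc 0"] i1 VV by metis
        then show False using one[OF N1(3)] HH by simp
      qed
    next
      case False
      \<comment> \<open>Now every crossing passes two walls, so it cannot start at \<open>j\<close>;
        the letter would have to stay at \<open>f\<close>, which \<open>V\<close> moves.\<close>
      then have "2 \<le> R" using V2 by simp
      then have "i n \<noteq> j" if "n \<le> N + 1" for n
        using two[OF that] x[of n] by auto
      then have "i 0 = f" "i (Suc 0) = f" using i_cases N1 by blast+
      then show False using from_f[of 0] f(2) by simp
    qed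
  qed
qed

context tiled
begin

text \<open>The geodesic is compared with the point where it crosses the vertical line through the target:
  there the displacement is a multiple of \<open>- q' e1 + q e2 = (0, \<plusminus>1)\<close>.\<close>

lemma near_along_cylinder:
  assumes t: "0 \<le> t" and start: "\<gamma> t = P x0 0 i" "x0 \<in> {0..<1}"
    and x: "0 \<le> x" "y \<in> {0..1}" "x0 * q \<le> x * q + y * q'" "x - x0 \<le> X / Y" and q: "0 < q"
  shows "\<exists>s\<in>{t..t + 1 / Y}. near (\<gamma> s) (E x y i) (1 / q)"
proof -
  \<comment> \<open>\<open>d\<close> is the horizontal speed of the geodesic, and \<open>s\<close>
    the time at which its horizontal coordinate agrees with that of the target.\<close>
  define d where "d = q' * Y + q * X"
  have d: "0 < d" unfolding d_def using q q_nonneg X_pos Y_pos by (simp add: add_nonneg_pos)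
  define s where "s = (y * q' + (x - x0) * q) / d"
  have s0: "0 \<le> s" unfolding s_def using x d by (intro divide_nonneg_pos) (auto simp: algebra_simps)
  have "(y * q' + (x - x0) * q) * Y \<le> d"
  proof -
    have "(x - x0) * Y \<le> X" using x Y_pos by (simp add: field_simps)
    then have "((x - x0) * Y) * q \<le> X * q" using q by (intro mult_right_mono) auto
    moreover have "y * (q' * Y) \<le> 1 * (q' * Y)" using x q_nonneg Y_pos by (intro mult_right_mono) auto
    ultimately show ?thesis by (simp add: d_def algebra_simps)
  qed
  then have s1: "s * Y \<le> 1" using d by (simp add: s_def)
  have sY: "0 \<le> s * Y" "0 \<le> s * X" using s0 Y_pos X_pos by simp_all
  have flow: "\<gamma> (t + s) = E (x0 + s * X) (s * Y) i"
    using E_flow[of t x0 0 i s] t start x s0 s1 E_unit by simp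
  let ?dx = "x0 + s * X - x" and ?dy = "s * Y - y"
  have "s * d = y * q' + (x - x0) * q" using d by (simp add: s_def)
  then have zero: "?dx * q + ?dy * q' = 0" by (simp add: d_def algebra_simps)
  have "q * (?dx * p + ?dy * p') = (?dx * q) * p + ?dy * (q * p')" by (simp add: algebra_simps)
  also have "?dx * q = - ?dy * q'" using zero by linarith
  finally have "q * (?dx * p + ?dy * p') = ?dy * (q * p' - q' * p)" by (simp add: algebra_simps)
  then have "\<bar>q * (?dx * p + ?dy * p')\<bar> = \<bar>?dy\<bar>" using det by (simp add: abs_mult)
  then have "q * \<bar>?dx * p + ?dy * p'\<bar> = \<bar>?dy\<bar>" using q by (simp add: abs_mult)
  moreover have "\<bar>?dy\<bar> \<le> 1" using x s1 sY by auto
  ultimately have "\<bar>?dx * p + ?dy * p'\<bar> \<le> 1 / q" using q by (simp add: field_simps)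
  then have "near (\<gamma> (t + s)) (E x y i) (1 / q)"
    unfolding flow using E_near[of "x0 + s * X" x "s * Y" y i] x s1 sY start(2) zero
    by (auto intro: near_mono)
  moreover have "s \<le> 1 / Y" using s1 Y_pos by (simp add: field_simps)
  ultimately show ?thesis using s0 by (intro bexI[of _ "t + s"]) auto
qed

lemma first_return:
  assumes "0 \<le> t" "\<gamma> t = P x 0 i" "x \<in> {0..<1}"
  shows "\<gamma> (t + 1 / Y) = P (frac (x + X / Y)) 0 (V ((H ^^ nat \<lfloor>x + X / Y\<rfloor>) i))"
proof -
  have "\<gamma> (t + 1 / Y) = E (x + X / Y) 1 i"
    using E_flow[of t x 0 i "1 / Y"] assms Y_pos E_unit by simp
  also have "\<dots> = P (frac (x + X / Y)) 0 (V ((H ^^ nat \<lfloor>x + X / Y\<rfloor>) i))"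
    unfolding E_def by (rule glueV) (simp add: frac_lt_1 less_imp_le)
  finally show ?thesis .
qed

lemma reaches_bottom:
  assumes "0 \<le> t"
  shows "\<exists>s\<in>{t..t + 1 / Y}. \<exists>x\<in>{0..<1}. \<exists>i. \<gamma> s = P x 0 i"
proof -
  obtain x y i where xy: "x \<in> {0..<1}" "y \<in> {0..<1}" "\<gamma> t = P x y i"
    using P_onto[OF surface[OF assms]] by blast
  define s where "s = (1 - y) / Y"
  have s: "0 \<le> s" "s \<le> 1 / Y" "y + s * Y = 1"
    using xy Y_pos by (auto simp: s_def field_simps)
  have "\<gamma> (t + s) = E (x + s * X) 1 i"
    using E_flow[of t x y i s] assms xy s E_unit by simp
  also have "\<dots> = P (frac (x + s * X)) 0 (V ((H ^^ nat \<lfloor>x + s * X\<rfloor>) i))"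
    unfolding E_def by (rule glueV) (simp add: frac_lt_1 less_imp_le)
  finally have "\<gamma> (t + s) = P (frac (x + s * X)) 0 (V ((H ^^ nat \<lfloor>x + s * X\<rfloor>) i))" .
  moreover have "frac (x + s * X) \<in> {0..<1}" by (simp add: frac_lt_1)
  moreover have "t + s \<in> {t..t + 1 / Y}" using s by simp
  ultimately show ?thesis by blast
qed

definition return :: "real \<times> tile \<Rightarrow> real \<times> tile" where
  "return z = (frac (fst z + X / Y), V ((H ^^ nat \<lfloor>fst z + X / Y\<rfloor>) (snd z)))"

lemma returns:
  assumes "0 \<le> t" "\<gamma> t = P x 0 i" "x \<in> {0..<1}"
  shows "\<gamma> (t + real n / Y) = P (fst ((return ^^ n) (x, i))) 0 (snd ((return ^^ n) (x, i))) \<and>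
    fst ((return ^^ n) (x, i)) \<in> {0..<1}"
proof (induction n)
  case 0
  then show ?case using assms by simp
next
  case (Suc n)
  obtain x' i' where z: "(return ^^ n) (x, i) = (x', i')" by force
  have "0 \<le> t + real n / Y" using assms Y_pos by simp
  then have "\<gamma> (t + real n / Y + 1 / Y) = P (fst (return (x', i'))) 0 (snd (return (x', i')))"
    using first_return[of "t + real n / Y" x' i'] Suc z return_def[of "(x', i')"] by simp
  moreover have "fst (return (x', i')) \<in> {0..<1}"
    using return_def[of "(x', i')"] by (simp add: frac_lt_1)
  moreover have eq: "t + real (Suc n) / Y = t + real n / Y + 1 / Y"
    by (simp add: add_divide_distrib)
  ultimately show ?case
    unfolding eq using z by simp
qed

text \<open>\<open>P_flow\<close> runs forward only, so returns are followed from a bottom side met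
  by time \<open>1 / Y\<close> to the last one not after \<open>t\<close>; injectivity shows that
  this one is the crossing at \<open>t\<close>. At least one return is needed, whence the bound
  \<open>2 / Y\<close>.\<close>

lemma bottom_predecessor:
  assumes t: "2 / Y \<le> t" and bottom: "\<gamma> t = P x 0 j" "x \<in> {0..<1}"
  shows "\<exists>x'\<in>{0..<1}. \<exists>i. \<gamma> (t - 1 / Y) = P x' 0 i \<and> x = frac (x' + X / Y) \<and>
    j = V ((H ^^ nat \<lfloor>x' + X / Y\<rfloor>) i)"
proof -
  obtain t1 x1 i1 where t1: "t1 \<in> {0..0 + 1 / Y}" "x1 \<in> {0..<1}" "\<gamma> t1 = P x1 0 i1"
    using reaches_bottom[of 0] by auto
  have tt: "1 / Y \<le> t - t1" using t t1 by auto
  define n where "n = nat \<lfloor>(t - t1) * Y\<rfloor>"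
  have tY: "1 \<le> (t - t1) * Y" using tt Y_pos by (simp add: field_simps)
  then have n: "1 \<le> n" "real n \<le> (t - t1) * Y" "(t - t1) * Y < real n + 1"
    unfolding n_def by (auto simp: of_nat_nat le_nat_iff le_floor_iff)
  define z where "z = (return ^^ n) (x1, i1)"
  define u where "u = t1 + real n / Y"
  define s where "s = t - u"
  have s: "0 \<le> s" "s * Y < 1"
  proof -
    have sY: "s * Y = (t - t1) * Y - real n"
      using Y_pos by (simp add: s_def u_def left_diff_distrib distrib_right)
    then show "s * Y < 1" using n by simp
    show "0 \<le> s" using sY n Y_pos by (metis diff_ge_0_iff_ge zero_le_mult_iff not_less_iff_gr_or_eq not_le)
  qed
  have z: "\<gamma> u = P (fst z) 0 (snd z)" "fst z \<in> {0..<1}" "0 \<le> u"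
    using returns[of t1 x1 i1 n] t1 Y_pos by (auto simp: z_def u_def)
  have "\<gamma> (u + s) = E (fst z + s * X) (s * Y) (snd z)"
    using E_flow[of u "fst z" 0 "snd z" s] z s E_unit by simp
  then have "P x 0 j = P (frac (fst z + s * X)) (s * Y) ((H ^^ nat \<lfloor>fst z + s * X\<rfloor>) (snd z))"
    using bottom by (simp add: s_def E_def)
  moreover have "P x 0 j \<noteq> w"
    using bottom no_vertex[of t] t Y_pos by (metis divide_nonneg_pos order_trans zero_le_numeral)
  ultimately have "s * Y = 0"
    using P_inj[of x 0 j "frac (fst z + s * X)" "s * Y"] bottom(2) s Y_pos
    by (auto simp: frac_lt_1)
  then have tu: "t = u" using Y_pos by (simp add: s_def)
  have "P x 0 j = P (fst z) 0 (snd z)"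
    using bottom(1) z(1) tu by simp
  then have "x = fst z \<and> j = snd z"
    using P_inj \<open>P x 0 j \<noteq> w\<close> bottom(2) z(2) by simp
  moreover obtain n' where n': "n = Suc n'" using n(1) by (cases n) auto
  define z' where "z' = (return ^^ n') (x1, i1)"
  have "z = return z'" by (simp add: z_def z'_def n')
  moreover have "t - 1 / Y = t1 + real n' / Y"
    by (simp add: tu u_def n' add_divide_distrib)
  then have "\<gamma> (t - 1 / Y) = P (fst z') 0 (snd z')" "fst z' \<in> {0..<1}"
    using returns[of t1 x1 i1 n'] t1 by (auto simp: z'_def)
  ultimately show ?thesis
    by (intro bexI[of _ "fst z'"] exI[of _ "snd z'"]) (auto simp: return_def)
qed

text \<open>A target to the right of the crossing point is served by the crossing that starts there.
  One to the left is projected vertically to the bottom side, which is part of the top of the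
  cylinder crossed before: the previous crossing comes within \<open>1 / q\<close> of the
  projection, and the projection costs another \<open>y / q\<close>.\<close>

lemma near_if_bottom_visited:
  assumes t: "2 / Y \<le> t" and bottom: "\<gamma> t = P x0 0 j" "x0 \<in> {0..<1}"
    and q: "0 < q" and R: "1 \<le> X / Y" and xy: "x \<in> {0..<1}" "y \<in> {0..<1}"
  shows "\<exists>s\<in>{t - 1 / Y..t + 1 / Y}. near (\<gamma> s) (P x y j) (2 / q)"
proof (cases "x0 * q \<le> x * q + y * q'")
  case True
  have "0 \<le> t" using t Y_pos by (meson divide_nonneg_pos order_trans zero_le_numeral)
  moreover have "x - x0 \<le> X / Y" using xy bottom(2) R by auto
  ultimately obtain s where s: "s \<in> {t..t + 1 / Y}" "near (\<gamma> s) (E x y j) (1 / q)"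
    using near_along_cylinder[of t x0 j x y] bottom xy q True by auto
  have "1 / q \<le> 2 / q" using q by (simp add: divide_right_mono)
  then have "near (\<gamma> s) (P x y j) (2 / q)"
    using s xy E_unit near_mono by simp
  then show ?thesis using s Y_pos by (intro bexI[of _ s]) (auto simp: algebra_simps add_increasing2)
next
  case False
  \<comment> \<open>\<open>u e1\<close> has the same horizontal component as
    \<open>x e1 + y e2\<close>.\<close>
  define u where "u = x + y * q' / q"
  have u: "0 \<le> u" "u < x0"
    using False xy q q_nonneg by (auto simp: u_def field_simps)
  obtain x' i where pred: "x' \<in> {0..<1}" "\<gamma> (t - 1 / Y) = P x' 0 i" "x0 = frac (x' + X / Y)"
    "j = V ((H ^^ nat \<lfloor>x' + X / Y\<rfloor>) i)"
    using bottom_predecessor[OF t bottom] by blast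
  define m where "m = nat \<lfloor>x' + X / Y\<rfloor>"
  have "0 \<le> \<lfloor>x' + X / Y\<rfloor>" using pred(1) R by auto
  then have x0: "x0 = x' + X / Y - real m" using pred(3) by (simp add: m_def frac_def)
  then have m: "1 \<le> real m"
  proof -
    have "1 \<le> \<lfloor>x' + X / Y\<rfloor>" using pred(1) R by (auto simp: le_floor_iff)
    then show ?thesis by (simp add: m_def)
  qed
  have t0: "0 \<le> t - 1 / Y" using t Y_pos by (smt (verit) divide_right_mono)
  have "x' * q \<le> (u + real m) * q + 1 * q'"
  proof -
    have "x' * q \<le> (u + real m) * q" using pred(1) u m q by (intro mult_right_mono) auto
    then show ?thesis using q_nonneg by simp
  qed
  then obtain s where s: "s \<in> {t - 1 / Y..t - 1 / Y + 1 / Y}" "near (\<gamma> s) (E (u + real m) 1 i) (1 / q)"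
    using near_along_cylinder[of "t - 1 / Y" x' i "u + real m" 1] t0 pred u x0 q by auto
  have u1: "u \<in> {0..1}" using u bottom(2) by auto
  have "E (u + real m) 1 i = P u 1 ((H ^^ m) i)"
    using E_cell[of m "u + real m" 1 i] u1 by simp
  also have "\<dots> = P u 0 j" using glueV[OF u1] pred(4) by (simp add: m_def)
  finally have s': "near (\<gamma> s) (P u 0 j) (1 / q)" using s by simp
  have "near (P u 0 j) (P x y j) (\<bar>(u - x) * q + (0 - y) * q'\<bar> + \<bar>(u - x) * p + (0 - y) * p'\<bar>)"
    by (rule P_near) (use u1 xy in auto)
  moreover have "(u - x) * q + (0 - y) * q' = 0" using q by (simp add: u_def)
  moreover have "(u - x) * p + (0 - y) * p' = - (y / q) * (q * p' - q' * p)"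
    using q by (simp add: u_def field_simps)
  then have "\<bar>(u - x) * p + (0 - y) * p'\<bar> = y / q"
    using det q xy by (simp add: abs_mult)
  then have "\<bar>(u - x) * p + (0 - y) * p'\<bar> \<le> 1 / q"
    using q xy by (simp add: divide_right_mono)
  ultimately have "near (P u 0 j) (P x y j) (1 / q)"
    by (auto intro: near_mono)
  then have "near (\<gamma> s) (P x y j) (1 / q + 1 / q)"
    by (rule near_trans[OF s']) (use P_surface u1 in auto)
  then have "near (\<gamma> s) (P x y j) (2 / q)"
    by (rule near_mono) simp
  then show ?thesis using s Y_pos by (intro bexI[of _ s]) (auto simp: add_increasing2)
qed

text \<open>In units of \<open>1 / Y\<close>: at most one to reach a bottom side,
  \<open>N + 1\<close> returns, and part of one further crossing, hence
  \<open>N + 3\<close>.\<close>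

lemma left_edges_visited:
  assumes H2: "H \<circ> H = id" and V2: "V \<circ> V = id \<or> 2 \<le> X / Y" and R: "1 \<le> X / Y"
    and c: "\<And>z::int. c \<le> \<bar>X / Y - of_int z\<bar>" and N: "1 \<le> c * real N" and t: "0 \<le> t"
  shows "\<exists>s\<in>{t..t + (real N + 3) / Y}. \<exists>y\<in>{0..<1}. \<gamma> s = P 0 y j"
proof -
  obtain t1 x1 i1 where t1: "t1 \<in> {t..t + 1 / Y}" "x1 \<in> {0..<1}" "\<gamma> t1 = P x1 0 i1"
    using reaches_bottom[OF t] by auto
  define x where "x n = fst ((return ^^ n) (x1, i1))" for n
  define i where "i n = snd ((return ^^ n) (x1, i1))" for n
  have orbit: "\<gamma> (t1 + real n / Y) = P (x n) 0 (i n)" "x n \<in> {0..<1}" for n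
    using returns[of t1 x1 i1 n] t1 t by (auto simp: x_def i_def)
  have "\<exists>n\<le>N + 1. \<exists>l. 1 \<le> l \<and> real l \<le> x n + X / Y \<and> (H ^^ l) (i n) = j"
    by (rule return_visits[OF gen H2 V2 R c N orbit(2)]) (auto simp: x_def i_def return_def)
  then obtain n l where nl: "n \<le> N + 1" "1 \<le> l" "real l \<le> x n + X / Y" "(H ^^ l) (i n) = j"
    by blast
  define s where "s = (real l - x n) / X"
  have "real l - x n \<ge> 0" using nl(2) orbit(2)[of n] by auto
  then have s0: "0 \<le> s" using X_pos by (simp add: s_def)
  have sX: "x n + s * X = real l" using X_pos by (simp add: s_def)
  then have "s * X \<le> X / Y" using nl(3) by simp
  then have s1: "s * Y \<le> 1" "s \<le> 1 / Y" using X_pos Y_pos by (auto simp: field_simps)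
  have tn: "0 \<le> t1 + real n / Y" using t t1 Y_pos by auto
  have "\<gamma> (t1 + real n / Y + s) = E (real l) (s * Y) (i n)"
    using E_flow[OF tn, of "x n" 0 "i n" s] orbit[of n] E_unit s0 s1 sX by simp
  also have "\<dots> = P 0 (s * Y) j"
    using E_cell[of l "real l" "s * Y" "i n"] nl(4) s0 s1 Y_pos by simp
  finally have visit: "\<gamma> (t1 + real n / Y + s) = P 0 (s * Y) j" .
  then have "s * Y \<noteq> 1"
    using no_vertex[of "t1 + real n / Y + s"] P_vertex_corners(2) tn s0 by auto
  then have y01: "s * Y \<in> {0..<1}" using s0 s1 Y_pos by simp
  have "real n / Y \<le> (real N + 1) / Y"
    using nl(1) Y_pos by (intro divide_right_mono) auto
  moreover have "0 \<le> real n / Y" using Y_pos by simp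
  ultimately have "t1 + real n / Y + s \<in> {t..t + (real N + 3) / Y}"
    using t1 s0 s1(2) unfolding add_divide_distrib atLeastAtMost_iff by linarith
  then show ?thesis using visit y01 by blast
qed

text \<open>The left sides one level deeper are the bottom sides of this level.\<close>

lemma dense_level:
  assumes m: "real m * Y < X" and R: "1 \<le> X / Y" and q: "0 < q"
    and H2: "(V \<circ> H ^^ m) \<circ> (V \<circ> H ^^ m) = id" and V2: "H \<circ> H = id \<or> 2 \<le> Y / (X - real m * Y)"
    and R': "1 \<le> Y / (X - real m * Y)"
    and c: "\<And>z::int. c \<le> \<bar>Y / (X - real m * Y) - of_int z\<bar>" and N: "1 \<le> c * real N"
    and Q: "Q \<in> L_surface"
  shows "\<exists>t\<in>{0..(real N + 3) / (X - real m * Y) + 3 / Y}. near (\<gamma> t) Q (2 / q)"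
proof -
  interpret up: tiled \<gamma> w "\<lambda>x y i. E (real m * x + y) x i" "V \<circ> (H ^^ m)" H Y "X - real m * Y"
    "real m * q + q'" q "real m * p + p'" p
    by (rule step[OF m])
  obtain x y j where xy: "x \<in> {0..<1}" "y \<in> {0..<1}" "Q = P x y j"
    using P_onto[OF Q] by blast
  \<comment> \<open>The search starts at \<open>2 / Y\<close> so that the bottom crossing it finds
    has a predecessor.\<close>
  have Y2: "0 \<le> 2 / Y" using Y_pos by simp
  obtain s z where s: "s \<in> {2 / Y..2 / Y + (real N + 3) / (X - real m * Y)}" "z \<in> {0..<1}"
    "\<gamma> s = E (real m * 0 + z) 0 j"
    using up.left_edges_visited[OF H2 V2 R' c N Y2, of j] by blast
  then have "\<gamma> s = P z 0 j" using E_unit by simp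
  then obtain u where u: "u \<in> {s - 1 / Y..s + 1 / Y}" "near (\<gamma> u) (P x y j) (2 / q)"
    using near_if_bottom_visited[of s z j x y] s q R xy by auto
  have "2 / Y = 1 / Y + 1 / Y" "3 / Y = 2 / Y + 1 / Y" by (simp_all add: add_divide_distrib[symmetric])
  moreover have "0 \<le> 1 / Y" using Y_pos by simp
  ultimately have "u \<in> {0..(real N + 3) / (X - real m * Y) + 3 / Y}"
    using u s by auto
  then show ?thesis using u xy by blast
qed

end

section \<open>Developing a geodesic\<close>

lemma tile_rep_add:
  "tile_rep (0 < fst v) (0 < snd v) (x + s * \<bar>snd v\<bar>) (y + s * \<bar>fst v\<bar>) i =
    tile_rep (0 < fst v) (0 < snd v) x y i + s *\<^sub>R v"
  by (cases v) (auto simp: tile_rep_def flip_def abs_if algebra_simps)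

lemma tile_rep_coords:
  "tile_rep b c (flip c (snd (z - corner i))) (flip b (fst (z - corner i))) i = z"
  by (cases z; cases i) (auto simp: tile_rep_def flip_def)

lemma interior_class:
  assumes "(tile_rep b c x y i, z) \<in> L_rel" "0 < x" "x < 1" "0 < y" "y < 1"
  shows "z = tile_rep b c x y i"
proof -
  have "tile_rep b c x y i \<notin> {0,1,2} \<times> {0,1,2}"
    using assms(2-) by (cases i; cases b; cases c) (auto simp: tile_rep_def flip_def)
  moreover have "(tile_rep b c x y i, z) \<notin> L_glue \<union> L_glue\<inverse>"
    using assms(2-) by (cases z; cases i; cases b; cases c) (auto simp: tile_rep_def flip_def L_glue_iff)
  ultimately show ?thesis
    using L_rel_cases[OF assms(1)] by auto
qed

text \<open>Along \<open>v\<close> the coordinates in each reflected square increase. For small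
  \<open>s\<close> a negative coordinate of \<open>z\<close> stays negative, so the square
  containing \<open>z + s *\<^sub>R v\<close> already contains \<open>z\<close>, with both
  coordinates below 1.\<close>

lemma region_forward:
  assumes "fst v \<noteq> 0" "snd v \<noteq> 0" "0 < e" and ray: "\<And>s. s \<in> {0..<e} \<Longrightarrow> z + s *\<^sub>R v \<in> L_region"
  shows "\<exists>x\<in>{0..<1}. \<exists>y\<in>{0..<1}. \<exists>i. z = tile_rep (0 < fst v) (0 < snd v) x y i"
proof -
  let ?b = "0 < fst v" and ?c = "0 < snd v"
  define a where "a i = flip ?c (snd (z - corner i))" for i
  define d where "d i = flip ?b (fst (z - corner i))" for i
  have z: "z = tile_rep ?b ?c (a i) (d i) i" for i
    unfolding a_def d_def by (rule tile_rep_coords[symmetric])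
  have ev: "\<forall>\<^sub>F s in at_right 0. u < 0 \<longrightarrow> u + s * l < 0" for u l :: real
  proof (cases "u < 0")
    case True
    have "((\<lambda>s. u + s * l) \<longlongrightarrow> u + 0 * l) (at_right 0)"
      by (intro tendsto_intros)
    then have "\<forall>\<^sub>F s in at_right 0. u + s * l < 0"
      by (rule order_tendstoD(2)) (use True in simp)
    then show ?thesis by (auto elim: eventually_mono)
  qed simp
  have "\<forall>\<^sub>F s in at_right 0. \<forall>i\<in>UNIV. (a i < 0 \<longrightarrow> a i + s * \<bar>snd v\<bar> < 0) \<and> (d i < 0 \<longrightarrow> d i + s * \<bar>fst v\<bar> < 0)"
    by (intro eventually_ball_finite ballI eventually_conj ev) simp
  moreover have "\<forall>\<^sub>F s in at_right 0. s \<in> {0<..<e}"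
    using assms(3) by (rule eventually_at_right_real)
  ultimately have "\<forall>\<^sub>F s in at_right 0. (\<forall>i\<in>UNIV. (a i < 0 \<longrightarrow> a i + s * \<bar>snd v\<bar> < 0) \<and>
      (d i < 0 \<longrightarrow> d i + s * \<bar>fst v\<bar> < 0)) \<and> s \<in> {0<..<e}"
    by (rule eventually_conj)
  then obtain s where s: "\<And>i. a i < 0 \<Longrightarrow> a i + s * \<bar>snd v\<bar> < 0"
    "\<And>i. d i < 0 \<Longrightarrow> d i + s * \<bar>fst v\<bar> < 0" "0 < s" "s < e"
    using eventually_happens'[OF trivial_limit_at_right_real] by fastforce
  have "z + s *\<^sub>R v \<in> L_region" using ray s by simp
  then obtain x y i where xy: "x \<in> {0..1}" "y \<in> {0..1}" "z + s *\<^sub>R v = tile_rep ?b ?c x y i"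
    using region_tile_rep by blast
  have "tile_rep ?b ?c (a i + s * \<bar>snd v\<bar>) (d i + s * \<bar>fst v\<bar>) i = tile_rep ?b ?c x y i"
    using xy(3) tile_rep_add[of v "a i" s "d i" i] z[of i] by simp
  then have eq: "a i + s * \<bar>snd v\<bar> = x" "d i + s * \<bar>fst v\<bar> = y"
    by (auto simp: tile_rep_def flip_def split: if_splits)
  have "0 < s * \<bar>snd v\<bar>" "0 < s * \<bar>fst v\<bar>" using assms s by simp_all
  moreover have "0 \<le> a i" "0 \<le> d i" using s(1)[of i] s(2)[of i] eq xy by force+
  ultimately have "a i \<in> {0..<1}" "d i \<in> {0..<1}" using eq xy by auto
  then show ?thesis using z[of i] by blast
qed

text \<open>Induction along the real line: at the infimum of the times off the straight line
  \<open>Z\<close>, the backward half of \<open>L_geodesic\<close> gives agreement there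
  (\<open>closed\<close>), and the forward half a little beyond (\<open>forward\<close>). Avoiding
  the vertex makes the lift unique.\<close>

lemma geodesic_flow:
  assumes geo: "L_geodesic \<gamma> v" and vertex: "\<forall>t\<ge>0. \<gamma> t \<noteq> L_vertex"
    and v: "fst v \<noteq> 0" "snd v \<noteq> 0" and b: "b = (0 < fst v)" "c = (0 < snd v)"
    and t: "0 \<le> t" "\<gamma> t = tile_pt b c x y i" and xy: "x \<in> {0..<1}" "y \<in> {0..<1}"
    and s: "0 \<le> s" "x + s * \<bar>snd v\<bar> \<le> 1" "y + s * \<bar>fst v\<bar> \<le> 1"
  shows "\<gamma> (t + s) = tile_pt b c (x + s * \<bar>snd v\<bar>) (y + s * \<bar>fst v\<bar>) i"
proof -
  define Z where "Z u = tile_rep b c (x + u * \<bar>snd v\<bar>) (y + u * \<bar>fst v\<bar>) i" for u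
  have Z_add: "Z u = Z 0 + u *\<^sub>R v" for u
    using tile_rep_add[of v x u y i] by (simp add: Z_def b)
  have v_pos: "0 < \<bar>fst v\<bar>" "0 < \<bar>snd v\<bar>" using v by auto
  have surf: "\<gamma> u \<in> L_surface" if "0 \<le> u" for u using geo that by (simp add: L_geodesic_def)
  have coord: "0 \<le> x + u * \<bar>snd v\<bar>" "0 \<le> y + u * \<bar>fst v\<bar>"
    "x + u * \<bar>snd v\<bar> \<le> 1" "y + u * \<bar>fst v\<bar> \<le> 1" if "u \<in> {0..s}" for u
  proof -
    have "u * \<bar>snd v\<bar> \<le> s * \<bar>snd v\<bar>" "u * \<bar>fst v\<bar> \<le> s * \<bar>fst v\<bar>"
      using that by (auto intro!: mult_right_mono)
    moreover have "0 \<le> u * \<bar>snd v\<bar>" "0 \<le> u * \<bar>fst v\<bar>" using that by auto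
    ultimately show "0 \<le> x + u * \<bar>snd v\<bar>" "0 \<le> y + u * \<bar>fst v\<bar>"
      "x + u * \<bar>snd v\<bar> \<le> 1" "y + u * \<bar>fst v\<bar> \<le> 1"
      using xy s by auto
  qed
  have coord_less: "x + u * \<bar>snd v\<bar> < 1" "y + u * \<bar>fst v\<bar> < 1" if "u \<in> {0..<s}" for u
  proof -
    have "u * \<bar>snd v\<bar> < s * \<bar>snd v\<bar>" "u * \<bar>fst v\<bar> < s * \<bar>fst v\<bar>"
      using that v_pos by (auto intro!: mult_strict_right_mono)
    then show "x + u * \<bar>snd v\<bar> < 1" "y + u * \<bar>fst v\<bar> < 1" using s by auto
  qed
  have forward: "\<exists>e>0. \<forall>r\<in>{0..<e}. Z (u + r) \<in> \<gamma> (t + (u + r))"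
    if u: "u \<in> {0..<s}" "Z u \<in> \<gamma> (t + u)" for u
  proof -
    have tu: "0 \<le> t + u" using t u by simp
    obtain z e where e: "0 < e" "\<And>r. r \<in> {0..<e} \<Longrightarrow> z + r *\<^sub>R v \<in> \<gamma> (t + u + r)"
      using geo tu unfolding L_geodesic_def by blast
    have "z + r *\<^sub>R v \<in> L_region" if "r \<in> {0..<e}" for r
      using e(2)[OF that] L_surface_subset[OF surf[of "t + u + r"]] tu that by auto
    then obtain x' y' j where z: "x' \<in> {0..<1}" "y' \<in> {0..<1}" "z = tile_rep b c x' y' j"
      using region_forward[OF v e(1)] b by blast
    have cls: "\<gamma> (t + u) = L_rel `` {Z u}"
      by (rule L_surface_eq_class[OF surf[OF tu] u(2)])
    then have rel: "(Z u, z) \<in> L_rel" using e(1) e(2)[of 0] by simp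
    have "(x + u * \<bar>snd v\<bar>, y + u * \<bar>fst v\<bar>) \<noteq> (0, 0)"
    proof
      assume "(x + u * \<bar>snd v\<bar>, y + u * \<bar>fst v\<bar>) = (0, 0)"
      then have "\<gamma> (t + u) = L_vertex"
        using cls tile_pt_corner[of b c i] by (simp add: Z_def tile_pt_def)
      then show False using vertex tu by blast
    qed
    then have "x + u * \<bar>snd v\<bar> = x' \<and> y + u * \<bar>fst v\<bar> = y' \<and> i = j"
      using coord[of u] coord_less[of u] u z
      by (intro tile_rep_inj[of b c]) (use rel in \<open>auto simp: Z_def\<close>)
    then have "z = Z u" using z by (simp add: Z_def)
    moreover have "Z (u + r) = Z u + r *\<^sub>R v" for r
      using Z_add[of u] Z_add[of "u + r"] by (simp add: algebra_simps)
    ultimately show ?thesis using e by (auto simp: add.assoc)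
  qed
  have closed: "Z u \<in> \<gamma> (t + u)"
    if u: "u \<in> {0<..s}" "\<And>r. r \<in> {0..<u} \<Longrightarrow> Z r \<in> \<gamma> (t + r)" for u
  proof -
    have tu: "0 \<le> t + u" using t u by simp
    obtain z e where e: "0 < e"
      "\<And>r. r \<in> {0..<e} \<Longrightarrow> r \<le> t + u \<Longrightarrow> z - r *\<^sub>R v \<in> \<gamma> (t + u - r)"
      using geo tu unfolding L_geodesic_def by blast
    \<comment> \<open>Shortly before \<open>u\<close> the line is inside an open square, where
      classes are singletons, so the backward piece of the path lies on the same lift.\<close>
    define r where "r = min e u / 2"
    have r: "0 < r" "r < e" "r < u" using e u by (auto simp: r_def)
    have "z - r *\<^sub>R v \<in> \<gamma> (t + u - r)" using e(2)[of r] r t by simp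
    moreover have Zr: "Z (u - r) \<in> \<gamma> (t + u - r)" using u(2)[of "u - r"] r by (simp add: add_diff_eq)
    moreover have "0 \<le> t + u - r" using t r by simp
    ultimately have "(Z (u - r), z - r *\<^sub>R v) \<in> L_rel"
      using L_surface_eq_class[OF surf Zr] by auto
    moreover have "0 < (u - r) * \<bar>snd v\<bar>" "0 < (u - r) * \<bar>fst v\<bar>" using r v_pos by auto
    then have "0 < x + (u - r) * \<bar>snd v\<bar>" "0 < y + (u - r) * \<bar>fst v\<bar>" using xy by auto
    moreover have "u - r \<in> {0..<s}" using r u by auto
    ultimately have "z - r *\<^sub>R v = Z (u - r)"
      unfolding Z_def using coord_less[of "u - r"] by (intro interior_class) auto
    then have "z = Z u" using Z_add[of u] Z_add[of "u - r"] by (simp add: algebra_simps)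
    then show ?thesis using e(1) e(2)[of 0] tu by simp
  qed
  have "Z s \<in> \<gamma> (t + s)"
  proof (rule ccontr)
    assume bad: "Z s \<notin> \<gamma> (t + s)"
    define Bad where "Bad = {u \<in> {0..s}. Z u \<notin> \<gamma> (t + u)}"
    define u where "u = Inf Bad"
    have sBad: "s \<in> Bad" using bad s by (simp add: Bad_def)
    have bdd: "bdd_below Bad" by (rule bdd_belowI[of _ 0]) (simp add: Bad_def)
    have u: "0 \<le> u" "u \<le> s"
      unfolding u_def using sBad bdd by (auto intro: cInf_greatest cInf_lower simp: Bad_def)
    have below: "Z r \<in> \<gamma> (t + r)" if "r \<in> {0..<u}" for r
    proof (rule ccontr)
      assume "Z r \<notin> \<gamma> (t + r)"
      then have "r \<in> Bad" using that u by (simp add: Bad_def)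
      then show False using cInf_lower[OF _ bdd, of r] that by (simp add: u_def)
    qed
    have Zu: "Z u \<in> \<gamma> (t + u)"
    proof (cases "u = 0")
      case True
      then show ?thesis
        using t L_class_self[OF tile_rep_region, of x y b c i] xy by (simp add: Z_def tile_pt_def)
    next
      case False
      then show ?thesis using closed[of u] below u by simp
    qed
    then have "u \<noteq> s" using bad by auto
    then obtain e where e: "0 < e" "\<And>r. r \<in> {0..<e} \<Longrightarrow> Z (u + r) \<in> \<gamma> (t + (u + r))"
      using forward[of u] Zu u by auto
    have "u + e \<le> r" if "r \<in> Bad" for r
    proof (rule ccontr)
      assume "\<not> u + e \<le> r"
      moreover have "u \<le> r" using cInf_lower[OF that bdd] by (simp add: u_def)
      ultimately have "Z (u + (r - u)) \<in> \<gamma> (t + (u + (r - u)))" by (intro e(2)) auto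
      then show False using that by (simp add: Bad_def)
    qed
    then have "u + e \<le> Inf Bad" using sBad by (intro cInf_greatest) auto
    then show False using e(1) by (simp add: u_def)
  qed
  then show ?thesis
    using L_surface_eq_class[OF surf] t s by (simp add: Z_def tile_pt_def)
qed

lemma half_open_onto:
  assumes "Q \<in> L_surface"
  shows "\<exists>x\<in>{0..<1}. \<exists>y\<in>{0..<1}. \<exists>i. Q = tile_pt b c x y i"
proof -
  obtain z where "z \<in> L_region" "Q = L_rel `` {z}"
    using assms by (auto simp: L_surface_def quotient_def)
  then obtain x y i where xy: "x \<in> {0..1}" "y \<in> {0..1}" "Q = tile_pt b c x y i"
    using region_tile_rep[of z b c] by (auto simp: tile_pt_def)
  obtain x' i' where x': "x' \<in> {0..<1}" "Q = tile_pt b c x' y i'"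
    using xy tile_pt_glueH[OF xy(2)] by (cases "x = 1") force+
  have x'1: "x' \<in> {0..1}" using x' by simp
  show ?thesis
  proof (cases "y = 1")
    case True
    then have "Q = tile_pt b c x' 0 (hswap i')" using x'(2) tile_pt_glueV[OF x'1] by simp
    moreover have "(0::real) \<in> {0..<1}" by simp
    ultimately show ?thesis using x'(1) by blast
  next
    case False
    then have "y \<in> {0..<1}" using xy(2) by simp
    then show ?thesis using x' by blast
  qed
qed

lemma tile_pt_inj:
  assumes "tile_pt b c x y i = tile_pt b c x' y' j" "tile_pt b c x y i \<noteq> L_vertex"
    and "x \<in> {0..<1}" "y \<in> {0..<1}" "x' \<in> {0..<1}" "y' \<in> {0..<1}"
  shows "x = x' \<and> y = y' \<and> i = j"
proof (rule tile_rep_inj[of b c])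
  have "tile_rep b c x' y' j \<in> tile_pt b c x' y' j"
    unfolding tile_pt_def using assms by (intro L_class_self tile_rep_region) auto
  then have "tile_rep b c x' y' j \<in> tile_pt b c x y i"
    by (simp only: assms(1))
  then show "(tile_rep b c x y i, tile_rep b c x' y' j) \<in> L_rel"
    by (simp add: tile_pt_def)
  show "(x, y) \<noteq> (0, 0)" using assms(2) tile_pt_corner[of b c i] by auto
qed (use assms in auto)

lemma tile_pt_near:
  assumes "x \<in> {0..1}" "y \<in> {0..1}" "x' \<in> {0..1}" "y' \<in> {0..1}"
  shows "near (tile_pt b c x y i) (tile_pt b c x' y' i) (\<bar>y - y'\<bar> + \<bar>x - x'\<bar>)"
proof -
  let ?p = "tile_rep b c x y i" and ?q = "tile_rep b c x' y' i"
  obtain S where S: "S \<in> L_squares" "?p \<in> S" "?q \<in> S"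
    using tile_rep_square[of b c i] assms by blast
  have "?p \<in> L_region" using S by (auto simp: L_region_def)
  then have "L_chain ?p ?q (0 + dist ?p ?q)"
    using S by (blast intro: L_chain.intros)
  moreover have "dist ?p ?q \<le> \<bar>y - y'\<bar> + \<bar>x - x'\<bar>"
  proof -
    have "dist ?p ?q = sqrt ((y - y')\<^sup>2 + (x - x')\<^sup>2)"
      by (cases i) (auto simp: tile_rep_def flip_def dist_Pair_Pair dist_real_def power2_commute)
    then show ?thesis using sqrt_sum_squares_le_sum_abs by simp
  qed
  moreover have "?p \<in> tile_pt b c x y i" "?q \<in> tile_pt b c x' y' i"
    unfolding tile_pt_def using assms by (auto intro!: L_class_self tile_rep_region simp del: Image_singleton_iff)
  ultimately show ?thesis unfolding near_def by fastforce
qed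

lemma generating_swaps: "generating vswap hswap"
  unfolding generating_def inj_tile tile_ex by simp

lemma tiled_geodesic:
  assumes geo: "L_geodesic \<gamma> v" and vertex: "\<forall>t\<ge>0. \<gamma> t \<noteq> L_vertex"
    and v: "fst v \<noteq> 0" "snd v \<noteq> 0"
  shows "tiled \<gamma> L_vertex (tile_pt (0 < fst v) (0 < snd v)) vswap hswap \<bar>snd v\<bar> \<bar>fst v\<bar> 0 1 1 0"
proof
  show "near (tile_pt (0 < fst v) (0 < snd v) x y i) (tile_pt (0 < fst v) (0 < snd v) x' y' i)
      (\<bar>(x - x') * 0 + (y - y') * 1\<bar> + \<bar>(x - x') * 1 + (y - y') * 0\<bar>)"
    if "x \<in> {0..1}" "y \<in> {0..1}" "x' \<in> {0..1}" "y' \<in> {0..1}" for x y x' y' i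
    using tile_pt_near[OF that] by simp
  show "\<gamma> (t + s) = tile_pt (0 < fst v) (0 < snd v) (x + s * \<bar>snd v\<bar>) (y + s * \<bar>fst v\<bar>) i"
    if "0 \<le> t" "\<gamma> t = tile_pt (0 < fst v) (0 < snd v) x y i" "x \<in> {0..<1}" "y \<in> {0..<1}" "0 \<le> s"
      "x + s * \<bar>snd v\<bar> \<le> 1" "y + s * \<bar>fst v\<bar> \<le> 1" for t x y i s
    using geodesic_flow[OF geo vertex v refl refl] that by blast
  show "x = x' \<and> y = y' \<and> i = j"
    if "tile_pt (0 < fst v) (0 < snd v) x y i = tile_pt (0 < fst v) (0 < snd v) x' y' j"
      "tile_pt (0 < fst v) (0 < snd v) x y i \<noteq> L_vertex"
      "x \<in> {0..<1}" "y \<in> {0..<1}" "x' \<in> {0..<1}" "y' \<in> {0..<1}" for x y i x' y' j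
    using that by (rule tile_pt_inj)
  show "tile_pt (0 < fst v) (0 < snd v) 1 y i = tile_pt (0 < fst v) (0 < snd v) 0 y (vswap i)"
    if "y \<in> {0..1}" for y i
    using that by (rule tile_pt_glueH)
  show "tile_pt (0 < fst v) (0 < snd v) x 1 i = tile_pt (0 < fst v) (0 < snd v) x 0 (hswap i)"
    if "x \<in> {0..1}" for x i
    using that by (rule tile_pt_glueV)
  show "\<gamma> t \<in> L_surface" if "0 \<le> t" for t
    using geo that by (simp add: L_geodesic_def)
qed (use v vertex in \<open>auto simp: tile_pt_corner generating_swaps
    intro: tile_pt_surface half_open_onto\<close>)

section \<open>Continued fractions\<close>

lemma frac_irrational: "x \<notin> \<rat> \<Longrightarrow> frac x \<notin> \<rat>"
  by (metis frac_def Rats_add Rats_of_int add.commute diff_add_cancel)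

lemma cf_remainder_irrational: "\<alpha> \<notin> \<rat> \<Longrightarrow> cf_remainder \<alpha> k \<notin> \<rat>"
proof (induction k)
  case (Suc k)
  then have "frac (cf_remainder \<alpha> k) \<notin> \<rat>" by (simp add: frac_irrational)
  then show ?case
    by (metis Rats_inverse cf_remainder.simps(2) inverse_eq_divide inverse_inverse_eq)
qed simp

lemma frac_pos_irrational:
  assumes "x \<notin> \<rat>"
  shows "0 < frac x"
proof -
  have "frac x \<noteq> 0" using assms Ints_subset_Rats by (auto simp: frac_eq_0_iff)
  then show ?thesis using frac_ge_0[of x] by linarith
qed

lemma cf_remainder_gt_1:
  assumes "\<alpha> \<notin> \<rat>"
  shows "1 < cf_remainder \<alpha> (Suc k)"
  using frac_pos_irrational[OF cf_remainder_irrational[OF assms, of k]] frac_lt_1[of "cf_remainder \<alpha> k"]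
  by simp

text \<open>If \<open>\<alpha> = [a0; a1, a2, ...]\<close> has fractional part below 1/2, then
  \<open>a1 \<ge> 2\<close> and \<open>- \<alpha> = [- a0 - 1; 1, a1 - 1, a2, ...]\<close>: the
  tails agree up to a shift by one.\<close>

lemma cf_remainder_uminus:
  assumes "\<alpha> \<notin> \<rat>" "frac \<alpha> < 1/2"
  shows "cf_remainder (- \<alpha>) (k + 3) = cf_remainder \<alpha> (k + 2)"
proof -
  define f where "f = frac \<alpha>"
  have f: "0 < f" "f < 1/2" using assms frac_pos_irrational by (auto simp: f_def)
  have "\<alpha> \<notin> \<int>" using assms Ints_subset_Rats by auto
  then have 1: "cf_remainder (- \<alpha>) (Suc 0) = 1 / (1 - f)"
    by (simp add: frac_neg f_def)
  have frac: "frac (1 / (1 - f)) = f / (1 - f)"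
  proof -
    have "1 / (1 - f) = f / (1 - f) + 1" using f by (simp add: field_simps)
    moreover have "f / (1 - f) \<in> {0..<1}" using f by simp
    ultimately show ?thesis by (simp add: frac_unique_iff)
  qed
  have "cf_remainder (- \<alpha>) (Suc (Suc 0)) = 1 / (f / (1 - f))"
    unfolding cf_remainder.simps(2)[of _ "Suc 0"] 1 frac ..
  also have "\<dots> = 1 / f - 1" using f by (simp add: field_simps)
  finally have 2: "cf_remainder (- \<alpha>) (Suc (Suc 0)) = 1 / f - 1" .
  have "frac (1 / f - 1) = frac (1 / f)"
    by (simp add: frac_def)
  with 2 have "cf_remainder (- \<alpha>) (0 + 3) = cf_remainder \<alpha> (0 + 2)"
    by (simp add: eval_nat_numeral f_def)
  then show ?thesis
    by (induction k) (assumption, simp only: add_Suc cf_remainder.simps(2))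
qed

declare cf_remainder.simps(2) [simp del]

text \<open>Needed because the reflections replace the slope by its absolute value. For fractional
  part above 1/2 the comparison is used with the roles of \<open>\<alpha>\<close> and
  \<open>- \<alpha>\<close> exchanged; finitely many leading digits only enlarge the bound.\<close>

lemma badly_approximable_uminus:
  assumes "badly_approximable \<alpha>"
  shows "badly_approximable (- \<alpha>)"
proof -
  have irr: "\<alpha> \<notin> \<rat>" "- \<alpha> \<notin> \<rat>"
    using assms by (auto simp: badly_approximable_def)
  obtain A where A: "\<And>i. cf_digit \<alpha> i \<le> A"
    using assms by (auto simp: badly_approximable_def)
  have "\<exists>n. \<forall>k\<ge>n. cf_digit (- \<alpha>) k \<le> A"
  proof (cases "frac \<alpha> < 1/2")
    case True
    have "cf_digit (- \<alpha>) k \<le> A" if "3 \<le> k" for k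
    proof -
      obtain j where "k = j + 3" using \<open>3 \<le> k\<close> le_Suc_ex[of 3 k] by (auto simp: add.commute)
      then show ?thesis
        using cf_remainder_uminus[OF irr(1) True, of j] A[of "j + 2"] by (simp only: cf_digit_def)
    qed
    then show ?thesis by blast
  next
    case False
    have "\<alpha> \<notin> \<int>" using irr Ints_subset_Rats by auto
    then have "frac (- \<alpha>) = 1 - frac \<alpha>" by (simp add: frac_neg)
    moreover have "frac \<alpha> \<noteq> 1/2"
      using frac_irrational[OF irr(1)] by (metis Rats_divide Rats_1 Rats_number_of)
    ultimately have less: "frac (- \<alpha>) < 1/2" using False by simp
    have "cf_digit (- \<alpha>) k \<le> A" if "2 \<le> k" for k
    proof -
      obtain j where "k = j + 2" using \<open>2 \<le> k\<close> le_Suc_ex[of 2 k] by (auto simp: add.commute)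
      then show ?thesis
        using cf_remainder_uminus[OF irr(2) less, of j] A[of "j + 3"]
        by (simp only: cf_digit_def minus_minus)
    qed
    then show ?thesis by blast
  qed
  then obtain n where n: "\<And>k. n \<le> k \<Longrightarrow> cf_digit (- \<alpha>) k \<le> A" by blast
  define B where "B = Max (insert A (cf_digit (- \<alpha>) ` {..<n}))"
  have "cf_digit (- \<alpha>) k \<le> B" for k
  proof (cases "k < n")
    case True
    then show ?thesis unfolding B_def by (intro Max_ge) auto
  next
    case False
    then have "cf_digit (- \<alpha>) k \<le> A" using n by simp
    also have "A \<le> B" unfolding B_def by (intro Max_ge) auto
    finally show ?thesis .
  qed
  then show ?thesis using irr by (auto simp: badly_approximable_def)
qed

text \<open>\<open>B\<close> bounds complete quotients rather than digits, since these are the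
  ratios \<open>X / Y\<close> of the levels.\<close>

locale bounded_digits =
  fixes \<beta> B :: real
  assumes pos: "0 < \<beta>" and irrational: "\<beta> \<notin> \<rat>"
    and bound: "\<And>k. cf_remainder \<beta> k \<le> B"
begin

abbreviation "r \<equiv> cf_remainder \<beta>"

lemma r_Suc: "r (Suc k) = 1 / (r k - real (nat \<lfloor>r k\<rfloor>))" and r_floor: "real (nat \<lfloor>r k\<rfloor>) < r k"
proof -
  have "0 < r k" using pos cf_remainder_gt_1[OF irrational, of "k - 1"] by (cases k) auto
  then have *: "real (nat \<lfloor>r k\<rfloor>) = of_int \<lfloor>r k\<rfloor>" by simp
  then show "r (Suc k) = 1 / (r k - real (nat \<lfloor>r k\<rfloor>))" by (simp add: frac_def cf_remainder.simps(2))
  show "real (nat \<lfloor>r k\<rfloor>) < r k"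
    unfolding * using frac_pos_irrational[OF cf_remainder_irrational[OF irrational, of k]]
    by (simp add: frac_def)
qed

lemma r_gt_1: "1 < r (Suc k)"
  using cf_remainder_gt_1[OF irrational] .

lemma B_gt_1: "1 < B"
  using r_gt_1[of 0] bound[of "Suc 0"] by linarith

text \<open>The fractional part is the reciprocal of the next quotient, which lies between
  \<open>1 + 1 / B\<close> and \<open>B\<close>; the lower end comes from the quotient after that.
  This supplies the separation \<open>c\<close> in \<open>return_visits\<close>.\<close>

lemma r_distance: "1 / (B + 1) \<le> \<bar>r k - of_int z\<bar>"
proof -
  have frac: "1 / B \<le> frac (r k)" for k
  proof -
    have "1 < 1 / frac (r k)" "1 / frac (r k) \<le> B"
      using r_gt_1[of k] bound[of "Suc k"] by (simp_all add: cf_remainder.simps(2))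
    moreover have "0 < frac (r k)"
      using frac_pos_irrational[OF cf_remainder_irrational[OF irrational]] .
    ultimately have "1 \<le> frac (r k) * B" by (simp add: field_simps)
    then show ?thesis using B_gt_1 by (simp add: pos_divide_le_eq)
  qed
  have "1 / (B + 1) \<le> 1 / B" using B_gt_1 by (intro divide_left_mono) auto
  then have low: "1 / (B + 1) \<le> frac (r k)" using frac[of k] by linarith
  have "1 + 1 / B \<le> r (Suc k)"
  proof -
    have "1 \<le> \<lfloor>r (Suc k)\<rfloor>" using r_gt_1[of k] by (simp add: le_floor_iff)
    then have "1 \<le> real_of_int \<lfloor>r (Suc k)\<rfloor>" by simp
    then show ?thesis using frac[of "Suc k"] unfolding frac_def by linarith
  qed
  then have "1 + 1 / B \<le> 1 / frac (r k)" by (simp add: cf_remainder.simps(2))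
  moreover have "0 < frac (r k)"
    using frac_pos_irrational[OF cf_remainder_irrational[OF irrational]] .
  ultimately have "frac (r k) \<le> B / (B + 1)"
    using B_gt_1 by (simp add: field_simps)
  also have "B / (B + 1) = 1 - 1 / (B + 1)" using B_gt_1 by (simp add: field_simps)
  finally have high: "frac (r k) \<le> 1 - 1 / (B + 1)" .
  show ?thesis
  proof (cases "z \<le> \<lfloor>r k\<rfloor>")
    case True
    then have "real_of_int z \<le> of_int \<lfloor>r k\<rfloor>" by simp
    then show ?thesis using low unfolding frac_def by linarith
  next
    case False
    then have "real_of_int \<lfloor>r k\<rfloor> + 1 \<le> of_int z" by linarith
    then show ?thesis using high unfolding frac_def by linarith
  qed
qed

definition N :: nat where "N = nat \<lceil>B + 1\<rceil>"

lemma N: "1 \<le> 1 / (B + 1) * real N"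
proof -
  have "B + 1 \<le> real N" unfolding N_def using B_gt_1 by linarith
  then show ?thesis using B_gt_1 by (simp add: field_simps)
qed

text \<open>The time bound of \<open>dense_level\<close> in units of \<open>1 / Y\<close>, after
  \<open>1 / (X - m Y) \<le> B / Y\<close>.\<close>

definition K :: real where "K = (real N + 3) * B + 3"

lemma K_pos: "0 < K"
  using B_gt_1 by (simp add: K_def add_pos_pos)

section \<open>Density at the levels of the algorithm\<close>

context
  fixes \<gamma> :: "real \<Rightarrow> (real \<times> real) set" and w :: "(real \<times> real) set"
begin

definition tiled_level where
  "tiled_level k P H V X Y q q' p p' \<longleftrightarrow> tiled \<gamma> w P H V X Y q q' p p' \<and> X / Y = r k"

lemma tiled_level_step:
  assumes "tiled_level k P H V X Y q q' p p'"
  defines "m \<equiv> nat \<lfloor>r k\<rfloor>"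
  shows "real m * Y < X" "Y / (X - real m * Y) = r (Suc k)"
    "\<exists>P'. tiled_level (Suc k) P' (V \<circ> H ^^ m) H Y (X - real m * Y) (real m * q + q') q (real m * p + p') p"
proof -
  interpret tiled \<gamma> w P H V X Y q q' p p' using assms by (simp add: tiled_level_def)
  have R: "X / Y = r k" using assms by (simp add: tiled_level_def)
  show m: "real m * Y < X"
    using r_floor[of k] Y_pos unfolding m_def R[symmetric] by (simp add: field_simps)
  have "Y / (X - real m * Y) = 1 / (X / Y - real m)"
    using Y_pos by (simp add: field_simps)
  then show R': "Y / (X - real m * Y) = r (Suc k)"
    unfolding r_Suc R m_def .
  show "\<exists>P'. tiled_level (Suc k) P' (V \<circ> H ^^ m) H Y (X - real m * Y) (real m * q + q') q (real m * p + p') p"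
    unfolding tiled_level_def R' using step[OF m] by blast
qed

text \<open>The conditions on permutations and quotient concern the next level, whose pair is
  \<open>V \<circ> H ^^ m\<close> and \<open>H\<close>.\<close>

lemma dense_good:
  assumes level: "tiled_level (Suc k) P H V X Y q q' p p'" and q: "0 < q"
    and H2: "(V \<circ> H ^^ nat \<lfloor>r (Suc k)\<rfloor>) \<circ> (V \<circ> H ^^ nat \<lfloor>r (Suc k)\<rfloor>) = id"
    and V2: "H \<circ> H = id \<or> 2 \<le> r (Suc (Suc k))"
    and Q: "Q \<in> L_surface"
  shows "\<exists>t\<in>{0..K / Y}. near (\<gamma> t) Q (2 / q)"
proof -
  interpret tiled \<gamma> w P H V X Y q q' p p' using level by (simp add: tiled_level_def)
  define m where "m = nat \<lfloor>r (Suc k)\<rfloor>"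
  have R: "X / Y = r (Suc k)" using level by (simp add: tiled_level_def)
  note step = tiled_level_step[OF level, folded m_def]
  obtain t where t: "t \<in> {0..(real N + 3) / (X - real m * Y) + 3 / Y}" "near (\<gamma> t) Q (2 / q)"
    using dense_level[OF step(1) _ q H2[folded m_def] _ _ _ N Q] r_gt_1[of k] r_gt_1[of "Suc k"] R V2
      r_distance[of "Suc (Suc k)"] step(2) by auto
  have "1 / (X - real m * Y) = (Y / (X - real m * Y)) / Y" using Y_pos by simp
  also have "\<dots> \<le> B / Y"
    unfolding step(2) using bound Y_pos by (intro divide_right_mono) auto
  finally have "1 / (X - real m * Y) \<le> B / Y" .
  then have "(real N + 3) * (1 / (X - real m * Y)) \<le> (real N + 3) * (B / Y)"
    by (intro mult_left_mono) auto
  then have "(real N + 3) / (X - real m * Y) + 3 / Y \<le> K / Y"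
    by (simp add: K_def add_divide_distrib)
  then show ?thesis using t by (intro bexI[of _ t]) auto
qed

lemma dense_weaken:
  assumes "\<exists>t\<in>{0..S}. near (\<gamma> t) Q (2 / q1)" "S \<le> T" "0 < q" "q \<le> q1"
  shows "\<exists>t\<in>{0..T}. near (\<gamma> t) Q (2 / q)"
proof -
  obtain t where "t \<in> {0..S}" "near (\<gamma> t) Q (2 / q1)" using assms(1) by blast
  moreover have "2 / q1 \<le> 2 / q" using assms by (intro divide_left_mono) auto
  ultimately show ?thesis using assms(2) by (intro bexI[of _ t]) (auto intro: near_mono)
qed

lemma tiled_level_next:
  assumes "tiled_level (Suc k) P H V X Y q q' p p'" "0 < q"
  defines "m \<equiv> nat \<lfloor>r (Suc k)\<rfloor>"
  shows "q \<le> real m * q + q'" "1 / (X - real m * Y) \<le> B * (1 / Y)" "0 < 1 / Y" "0 < 1 / (X - real m * Y)"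
    "generating H V"
proof -
  interpret tiled \<gamma> w P H V X Y q q' p p' using assms by (simp add: tiled_level_def)
  note step = tiled_level_step[OF assms(1), folded m_def]
  have "1 \<le> \<lfloor>r (Suc k)\<rfloor>" using r_gt_1[of k] by (simp add: le_floor_iff)
  then have "1 \<le> real m" by (simp add: m_def)
  then have "1 * q \<le> real m * q" using assms(2) by (intro mult_right_mono) auto
  then show "q \<le> real m * q + q'" using q_nonneg by simp
  have "1 / (X - real m * Y) = (Y / (X - real m * Y)) / Y" using Y_pos by simp
  also have "\<dots> \<le> B / Y"
    unfolding step(2) using bound Y_pos by (intro divide_right_mono) auto
  finally show "1 / (X - real m * Y) \<le> B * (1 / Y)" by simp
  show "0 < 1 / Y" "0 < 1 / (X - real m * Y)" using Y_pos step(1) by simp_all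
  show "generating H V" by (rule gen)
qed

text \<open>\<open>dense_good\<close> applies here or at one of the next two levels. Each level
  multiplies \<open>1 / Y\<close> by at most \<open>B\<close> and does not decrease
  \<open>q\<close>, so the factor \<open>B * B\<close> covers all three.\<close>

lemma dense_any:
  assumes level: "tiled_level (Suc k) P H V X Y q q' p p'" and q: "0 < q" and Q: "Q \<in> L_surface"
  shows "\<exists>t\<in>{0..K * B * B / Y}. near (\<gamma> t) Q (2 / q)"
proof -
  define m0 where "m0 = nat \<lfloor>r (Suc k)\<rfloor>"
  define m1 where "m1 = nat \<lfloor>r (Suc (Suc k))\<rfloor>"
  define m2 where "m2 = nat \<lfloor>r (Suc (Suc (Suc k)))\<rfloor>"
  define H1 where "H1 = V \<circ> H ^^ m0"
  define H2 where "H2 = H \<circ> H1 ^^ m1"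
  define H3 where "H3 = H1 \<circ> H2 ^^ m2"
  define Y1 where "Y1 = X - real m0 * Y"
  define Y2 where "Y2 = Y - real m1 * Y1"
  define q1 where "q1 = real m0 * q + q'"
  define q2 where "q2 = real m1 * q1 + q"
  obtain P1 p1 where level1: "tiled_level (Suc (Suc k)) P1 H1 H Y Y1 q1 q p1 p"
    using tiled_level_step(3)[OF level] unfolding H1_def Y1_def q1_def m0_def by blast
  note next0 = tiled_level_next[OF level q, folded m0_def, folded q1_def Y1_def]
  have q1: "0 < q1" using next0(1) q by linarith
  obtain P2 p2 where level2: "tiled_level (Suc (Suc (Suc k))) P2 H2 H1 Y1 Y2 q2 q1 p2 p1"
    using tiled_level_step(3)[OF level1] unfolding H2_def Y2_def q2_def m1_def by blast
  note next1 = tiled_level_next[OF level1 q1, folded m1_def, folded q2_def Y2_def]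
  have q2: "0 < q2" using next1(1) q1 by linarith
  have K0: "K * (1 / Y) \<le> K * B * B / Y"
  proof -
    have "1 \<le> B * B" using B_gt_1 by (simp add: less_1_mult less_imp_le)
    then have "(K * (1 / Y)) * 1 \<le> (K * (1 / Y)) * (B * B)"
      using K_pos next0(3) by (intro mult_left_mono) auto
    then show ?thesis by (simp add: algebra_simps)
  qed
  have K1: "K * (1 / Y1) \<le> K * B * B / Y"
  proof -
    have "K * (1 / Y1) \<le> K * (B * (1 / Y))" using next0(2) K_pos by (intro mult_left_mono) auto
    also have "\<dots> \<le> K * (B * (1 / Y)) * B"
      using mult_left_mono[of 1 B "K * (B * (1 / Y))"] K_pos next0(3) B_gt_1 by simp
    finally show ?thesis by (simp add: algebra_simps)
  qed
  have K2: "K * (1 / Y2) \<le> K * B * B / Y"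
  proof -
    have "1 / Y2 \<le> B * (1 / Y1)" by (rule next1(2))
    also have "\<dots> \<le> B * (B * (1 / Y))" using next0(2) B_gt_1 by (intro mult_left_mono) auto
    finally have "K * (1 / Y2) \<le> K * (B * (B * (1 / Y)))" using K_pos by (intro mult_left_mono) auto
    then show ?thesis by (simp add: algebra_simps)
  qed
  have good0: ?thesis if "H1 \<circ> H1 = id" "H \<circ> H = id \<or> 2 \<le> r (Suc (Suc k))"
    using dense_weaken[OF dense_good[OF level q that[unfolded H1_def m0_def] Q]] K0 q by simp
  have good1: ?thesis if "H2 \<circ> H2 = id" "H1 \<circ> H1 = id \<or> 2 \<le> r (Suc (Suc (Suc k)))"
    using dense_weaken[OF dense_good[OF level1 q1 that(1)[unfolded H2_def m1_def] that(2) Q]]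
      K1 q next0(1) by simp
  have good2: ?thesis if "H3 \<circ> H3 = id" "H2 \<circ> H2 = id \<or> 2 \<le> r (Suc (Suc (Suc (Suc k))))"
    using dense_weaken[OF dense_good[OF level2 q2 that(1)[unfolded H3_def m2_def] that(2) Q]]
      K2 q next0(1) next1(1) by simp
  have gen1: "generating H1 H" and gen2: "generating H2 H1"
    using next1(5) tiled_level_next(5)[OF level2 q2] by auto
  have floor_1: "nat \<lfloor>r (Suc j)\<rfloor> = 1" if "\<not> 2 \<le> r (Suc j)" for j
    using r_gt_1[of j] that by (simp add: floor_eq_iff nat_eq_iff)
  show ?thesis
  proof (cases "H1 \<circ> H1 = id")
    case True
    show ?thesis
    proof (cases "H \<circ> H = id \<or> 2 \<le> r (Suc (Suc k))")
      case False
      \<comment> \<open>\<open>H\<close> is a 3-cycle, so with digit 1 the product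
        \<open>H2 = H \<circ> H1\<close> is odd, and the involution \<open>H1\<close> provides its
        extra condition.\<close>
      then have "m1 = 1" using floor_1 by (simp add: m1_def)
      then have "H2 \<circ> H2 = id"
        using generating_involution_not[OF gen1] False by (simp add: H2_def)
      then show ?thesis using good1 True by blast
    qed (use good0 True in blast)
  next
    case False
    \<comment> \<open>\<open>H1\<close> is a 3-cycle, so \<open>H2\<close> is an involution for any
      digit; its extra condition needs a quotient of at least 2, and otherwise
      \<open>H3 = H1 \<circ> H2\<close> takes over.\<close>
    then have H2: "H2 \<circ> H2 = id"
      unfolding H2_def by (rule generating_not_involution[OF gen1])
    show ?thesis
    proof (cases "2 \<le> r (Suc (Suc (Suc k)))")
      case True
      then show ?thesis using good1 H2 by blast
    next
      case F: False
      then have "m2 = 1" using floor_1 by (simp add: m2_def)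
      then have "H3 \<circ> H3 = id"
        using generating_involution_not[OF gen2 False] by (simp add: H3_def)
      then show ?thesis using good2 H2 by blast
    qed
  qed
qed

text \<open>A level serving \<open>n\<close> serves \<open>Suc n\<close> too or is replaced by the
  next: \<open>1 \<le> q'\<close> makes \<open>q\<close> grow by at least 1, and
  \<open>q' \<le> q\<close> keeps the new value at most \<open>(B + 1) * q\<close>.\<close>

lemma level_exists:
  assumes base: "tiled_level 0 P0 H0 V0 X0 Y0 0 1 p0 p0'" and n: "1 \<le> n"
  shows "\<exists>k P H V X Y q q' p p'. tiled_level (Suc k) P H V X Y q q' p p' \<and>
    real n \<le> q \<and> q \<le> (B + 1) * real n \<and> 1 \<le> q' \<and> q' \<le> q \<and> X * q + Y * q' = Y0"
  using n
proof (induction n rule: nat_induct_at_least)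
  case base
  \<comment> \<open>Two steps are taken at once, because level 0 has \<open>q = 0\<close> and level
    1 has \<open>q' = 0\<close>.\<close>
  define m0 where "m0 = nat \<lfloor>r 0\<rfloor>"
  define m1 where "m1 = nat \<lfloor>r (Suc 0)\<rfloor>"
  obtain P1 where 1: "tiled_level (Suc 0) P1 (V0 \<circ> H0 ^^ m0) H0 Y0 (X0 - real m0 * Y0)
      (real m0 * 0 + 1) 0 (real m0 * p0 + p0') p0"
    using tiled_level_step(3)[OF assms(1)] unfolding m0_def by blast
  then have 1: "tiled_level (Suc 0) P1 (V0 \<circ> H0 ^^ m0) H0 Y0 (X0 - real m0 * Y0)
      1 0 (real m0 * p0 + p0') p0" by simp
  define Y1 where "Y1 = X0 - real m0 * Y0"
  obtain P2 p2 where 2: "tiled_level (Suc (Suc 0)) P2 (H0 \<circ> (V0 \<circ> H0 ^^ m0) ^^ m1) (V0 \<circ> H0 ^^ m0)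
      Y1 (Y0 - real m1 * Y1) (real m1 * 1 + 0) 1 p2 (real m0 * p0 + p0')"
    using tiled_level_step(3)[OF 1] unfolding m1_def Y1_def by blast
  have "1 \<le> \<lfloor>r (Suc 0)\<rfloor>" using r_gt_1[of 0] by (simp add: le_floor_iff)
  then have "1 \<le> real m1" by (simp add: m1_def)
  moreover have "real m1 \<le> B" using r_floor[of "Suc 0"] bound[of "Suc 0"] by (simp add: m1_def)
  moreover have "Y1 * (real m1 * 1 + 0) + (Y0 - real m1 * Y1) * 1 = Y0" by (simp add: algebra_simps)
  ultimately show ?case
    using 2 by (intro exI conjI) (assumption | simp)+
next
  case (Suc n)
  then obtain k P H V X Y q q' p p' where level: "tiled_level (Suc k) P H V X Y q q' p p'"
    and q: "real n \<le> q" "q \<le> (B + 1) * real n" "1 \<le> q'" "q' \<le> q" "X * q + Y * q' = Y0"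
    by blast
  have Bn: "(B + 1) * real n \<le> (B + 1) * real (Suc n)" using B_gt_1 by simp
  show ?case
  proof (cases "real (Suc n) \<le> q")
    case True
    have "q \<le> (B + 1) * real (Suc n)" using q(2) Bn by linarith
    then show ?thesis
      using level True q by (intro exI conjI) (assumption | simp)+
  next
    case False
    define m where "m = nat \<lfloor>r (Suc k)\<rfloor>"
    obtain P' where level': "tiled_level (Suc (Suc k)) P' (V \<circ> H ^^ m) H Y (X - real m * Y)
        (real m * q + q') q (real m * p + p') p"
      using tiled_level_step(3)[OF level] unfolding m_def by blast
    have "1 \<le> \<lfloor>r (Suc k)\<rfloor>" using r_gt_1[of k] by (simp add: le_floor_iff)
    then have m1: "1 \<le> real m" by (simp add: m_def)
    have q0: "0 < q" using q by linarith
    have "1 * q \<le> real m * q" using m1 q0 by (intro mult_right_mono) auto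
    then have lower: "real (Suc n) \<le> real m * q + q'" "q \<le> real m * q + q'"
      using q unfolding of_nat_Suc mult_1 by linarith+
    have upper: "real m * q + q' \<le> (B + 1) * real (Suc n)"
    proof -
      have "real m \<le> B" using r_floor[of "Suc k"] bound[of "Suc k"] by (simp add: m_def)
      then have "real m * q \<le> B * q" using q0 by (intro mult_right_mono) auto
      then have "real m * q + q' \<le> (B + 1) * q" using q(4) by (simp add: algebra_simps)
      also have "\<dots> \<le> (B + 1) * real (Suc n)" using False B_gt_1 by (intro mult_left_mono) auto
      finally show ?thesis .
    qed
    have "Y * (real m * q + q') + (X - real m * Y) * q = Y0" using q(5) by (simp add: algebra_simps)
    then show ?thesis
      using level' lower upper q by (intro exI conjI) (assumption | simp)+
  qed
qed

lemma dense_scale: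
  assumes base: "tiled_level 0 P0 H0 V0 X0 Y0 0 1 p0 p0'" and n: "1 \<le> n" and Q: "Q \<in> L_surface"
  shows "\<exists>t\<in>{0..K * B * B * (B + 1) * (B + 1) * 2 / Y0 * real n}. near (\<gamma> t) Q (1 / real n)"
proof -
  \<comment> \<open>The scale \<open>2 * n\<close> absorbs the 2 in \<open>2 / q\<close>.\<close>
  have "1 \<le> 2 * n" using n by simp
  from level_exists[OF base this]
  obtain k P H V X Y q q' p p' where level: "tiled_level (Suc k) P H V X Y q q' p p'"
    and q: "real (2 * n) \<le> q" "q \<le> (B + 1) * real (2 * n)" "q' \<le> q" "X * q + Y * q' = Y0"
    by blast
  have q0: "0 < q" using q(1) n by (simp add: less_le_trans)
  interpret tiled \<gamma> w P H V X Y q q' p p' using level by (simp add: tiled_level_def)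
  have Y0: "0 < Y0"
    using q(4) X_pos Y_pos q0 q_nonneg by (metis add_pos_nonneg mult_nonneg_nonneg mult_pos_pos less_imp_le)
  have "X / Y \<le> B"
    using bound[of "Suc k"] level by (simp add: tiled_level_def)
  then have "X \<le> B * Y" using Y_pos by (simp add: field_simps)
  then have "X * q \<le> (B * Y) * q" using q0 by (intro mult_right_mono) auto
  moreover have "Y * q' \<le> Y * q" using q(3) Y_pos by simp
  ultimately have "Y0 \<le> Y * ((B + 1) * q)" using q(4) by (simp add: algebra_simps)
  also have "\<dots> \<le> Y * ((B + 1) * ((B + 1) * real (2 * n)))"
    using q(2) Y_pos B_gt_1 by (intro mult_left_mono) auto
  finally have "1 / Y \<le> (B + 1) * (B + 1) * 2 * real n / Y0"
    using Y0 Y_pos by (simp add: field_simps)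
  then have "(K * B * B) * (1 / Y) \<le> (K * B * B) * ((B + 1) * (B + 1) * 2 * real n / Y0)"
    using K_pos B_gt_1 by (intro mult_left_mono) auto
  then have time: "K * B * B / Y \<le> K * B * B * (B + 1) * (B + 1) * 2 / Y0 * real n"
    by (simp add: algebra_simps)
  obtain t where t: "t \<in> {0..K * B * B / Y}" "near (\<gamma> t) Q (2 / q)"
    using dense_any[OF level q0 Q] by blast
  have "2 / q \<le> 1 / real n" using q(1) q0 n by (simp add: field_simps)
  then have "near (\<gamma> t) Q (1 / real n)" using t(2) near_mono by blast
  then show ?thesis using t(1) time by (intro bexI[of _ t]) auto
qed

end

end

section \<open>Superdensity\<close>

lemma irrational_slope_nonzero:
  assumes "slope v \<notin> \<rat>"
  shows "fst v \<noteq> 0" "snd v \<noteq> 0"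
  using assms by (auto simp: slope_def)

lemma badly_approximable_bounded_digits:
  assumes "badly_approximable \<alpha>" "0 < \<alpha>"
  shows "\<exists>B. bounded_digits \<alpha> B"
proof -
  obtain A where A: "\<And>k. cf_digit \<alpha> k \<le> A" and irr: "\<alpha> \<notin> \<rat>"
    using assms(1) by (auto simp: badly_approximable_def)
  have "cf_remainder \<alpha> k \<le> of_int A + 1" for k
    using A[of k] unfolding cf_digit_def by linarith
  then have "bounded_digits \<alpha> (of_int A + 1)"
    using assms(2) irr by unfold_locales
  then show ?thesis ..
qed

theorem theorem2:
  fixes \<gamma> :: "real \<Rightarrow> (real \<times> real) set" and v :: "real \<times> real"
  assumes "L_geodesic \<gamma> v"
    and "\<forall>t\<ge>0. \<gamma> t \<noteq> L_vertex"
    and "badly_approximable (slope v)"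
  shows "L_superdense \<gamma>"
proof -
  have "slope v \<notin> \<rat>" using assms(3) by (simp add: badly_approximable_def)
  note v = irrational_slope_nonzero[OF this]
  have "badly_approximable \<bar>slope v\<bar>"
    using assms(3) badly_approximable_uminus[OF assms(3)] by (simp add: abs_if)
  moreover have "0 < \<bar>slope v\<bar>" using v by (simp add: slope_def)
  ultimately obtain B where "bounded_digits \<bar>slope v\<bar> B"
    using badly_approximable_bounded_digits by blast
  then interpret bounded_digits "\<bar>slope v\<bar>" B .
  have base: "tiled_level \<gamma> L_vertex 0 (tile_pt (0 < fst v) (0 < snd v)) vswap hswap
      \<bar>snd v\<bar> \<bar>fst v\<bar> 0 1 1 0"
    unfolding tiled_level_def
    using tiled_geodesic[OF assms(1,2) v] by (simp add: slope_def abs_divide)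
  define C where "C = K * B * B * (B + 1) * (B + 1) * 2 / \<bar>fst v\<bar>"
  have "0 < C" using K_pos B_gt_1 v by (simp add: C_def)
  moreover have "\<exists>t\<in>{0..C * real n}. L_dist (\<gamma> t) Q \<le> 1 / real n"
    if "1 \<le> n" "Q \<in> L_surface" for n Q
    using dense_scale[OF base that] L_dist_le_near unfolding C_def by blast
  ultimately show ?thesis unfolding L_superdense_def by blast
qed

end
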